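(* Consider the plant model of the context, in which the supply and demand state processes $X(t),Y(t)$ have well-defined time averages and the decaying memory property. Suppose the Joint Purchasing and Pricing Algorithm (JPP) is implemented with $$\theta_m=\max_{\{k\in\{1,\ldots,K\}\,|\,\beta_{mk}>0\}}\left[\frac{V(P_{k,max}-\alpha_k)}{\beta_{mk}}+\sum_{i\in\{1,\ldots,M\},\,i\ne m}\frac{\beta_{ik}A_{i,max}}{\beta_{mk}}+2\mu_{m,max}\right]$$ and that $\mu_{m,max}\le Q_m(0)\le\theta_m+A_{m,max}$ for all $m\in\{1,\ldots,M\}$. Then for all $m\in\{1,\ldots,M\}$ and all slots $t\ge0$, $$\mu_{m,max}\le Q_m(t)\le Q_{m,max}:=\theta_m+A_{m,max},\qquad\text{where }Q_{m,max}=O(V).$$ Further, for any $\epsilon>0$ and any positive integer $T$ such that, for every $t_0\in\{0,1,2,\ldots\}$ and every history $H(t_0)$, $$\left|\phi^{opt}-\frac1T\sum_{\tau=t_0}^{t_0+T-1}\mathbb{E}\{\phi^*(\tau)\mid H(t_0)\}\right|\le\epsilon$$ and, for every $m$, $$\left|\frac1T\sum_{\tau=t_0}^{t_0+T-1}\mathbb{E}\Big\{A_m^*(\tau)-\sum_{k=1}^K\beta_{mk}Z_k^*(\tau)F_k(P_k^*(\tau),Y(\tau))\,\Big|\,H(t_0)\Big\}\right|\le\epsilon,$$ we have $$\liminf_{t\rightarrow\infty}\frac1t\sum_{\tau=0}^{t-1}\mathbb{E}\{\phi_{actual}(\tau)\}\ge\phi^{opt}-\frac{TB}V-\epsilon\left(1+\sum_{m=1}^M\frac{\max[\theta_m,A_{m,max}]}V\right),$$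 where $B=\frac12\sum_{m=1}^M\max[A_{m,max}^2,\mu_{m,max}^2]$.
   Context: **Plant model.** There are $M$ raw materials, $K$ products, and slots $t\in\{0,1,2,\ldots\}$. The nonnegative integer $\beta_{mk}$ is the number of units of material $m$ needed for one unit of product $k$ (each material is used by at least one product); $\alpha_k\ge0$ is the cost of assembling one unit of product $k$. *Supply and purchasing.* The supply state $X(t)=[(x_1(t),\ldots,x_M(t));(s_1(t),\ldots,s_M(t))]$ takes values in a finite or countably infinite set $\mathcal X$; $x_m(t)\ge0$ is the per-unit price of material $m$ and $s_m(t)\ge0$ the amount available. The purchase vector $\boldsymbol A(t)$ costs $c(\boldsymbol A(t),X(t))=\sum_{m=1}^Mx_m(t)A_m(t)$ and must lie in $\mathcal A(X(t))$, the set of integer vectors with $0\le A_m(t)\le\min[A_{m,max},s_m(t)]$ for all $m$ and $c(\boldsymbol A(t),X(t))\le c_{max}$ ($A_{m,max},c_{max}$ finite constants). *Demand and pricing.* The demand state $Y(t)$ takes values in a finite or countably infinite set $\mathcal Y$. Each slot the plant observes $\boldsymbol Q(t),X(t),Y(t)$, then chooses $\boldsymbol A(t)$, $Z_k(t)\in\{0,1\}$ ($1$ means product $k$ is offered) and prices $P_k(t)\in\mathcal P_k$, a compact set of nonnegative prices with maximum $P_{k,max}$. Consumers then generate integer demands $0\le D_k(t)\le D_{k,max}$ (finite integers); $D_k(t)$ depends on $P_k(t),Y(t)$ and is conditionally i.i.d. over all slots with the same $P_k(t),Y(t)$ values (its conditional law given the past, the whole exogenous processes $X,Y$, and the current decisions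 depends only on $P_k(t),Y(t)$), with mean $F_k(p,y)=\mathbb{E}\{D_k(t)\mid P_k(t)=p,Y(t)=y\}$ continuous in $p\in\mathcal P_k$ for each $y$. *Queues and profit.* The integer inventories evolve as $Q_m(t+1)=\max[Q_m(t)-\sum_k\beta_{mk}\tilde D_k(t),0]+A_m(t)$, where $\tilde D_k(t)$ is the number of units of product $k$ actually sold. Define $\mu_{m,max}=\sum_{k=1}^K\beta_{mk}D_{k,max}$ and $\phi_{actual}(t)=-c(\boldsymbol A(t),X(t))+\sum_{k=1}^KZ_k(t)\tilde D_k(t)(P_k(t)-\alpha_k)$. **JPP algorithm** (parameters $V>0$ and $\theta_m$). Let $1_k(t)=1$ if $Q_m(t)<\mu_{m,max}$ for some $m$ with $\beta_{mk}>0$, and $1_k(t)=0$ otherwise. Every slot $t$: (1) *Purchasing:* choose $\boldsymbol A(t)$ minimizing $Vc(\boldsymbol A(t),X(t))+\sum_{m=1}^MA_m(t)(Q_m(t)-\theta_m)$ subject to $\boldsymbol A(t)\in\mathcal A(X(t))$. (2) *Pricing:* for each $k$, if $1_k(t)=1$ set $Z_k(t)=0$. If $1_k(t)=0$, choose $P_k(t)\in\mathcal P_k$ maximizing $V(P_k(t)-\alpha_k)F_k(P_k(t),Y(t))+F_k(P_k(t),Y(t))\sum_{m=1}^M\beta_{mk}(Q_m(t)-\theta_m)$; if the maximum is positive set $Z_k(t)=1$, else set $Z_k(t)=0$. (3) *Queue update:* fulfil all demands for offered products, i.e. $Q_m(t+1)=Q_m(t)-\sum_{k=1}^K\beta_{mk}Z_k(t)D_k(t)+A_m(t)$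 (there is always enough material, so $\tilde D_k(t)=Z_k(t)D_k(t)$). Minimizers and maximizers are selected by a fixed rule depending only on the current $\boldsymbol Q(t),X(t),Y(t)$. **Time averages and optimal profit.** There are probability distributions $\pi(x)$ on $\mathcal X$, $\pi(y)$ on $\mathcal Y$ with $\lim_{t\to\infty}\frac1t\sum_{\tau=0}^{t-1}1\{Y(\tau)=y\}=\pi(y)$ and $\lim_{t\to\infty}\frac1t\sum_{\tau=0}^{t-1}1\{X(\tau)=x\}=\pi(x)$ with probability 1 for all $x,y$. $\phi^{opt}$ is the maximum of $-\hat c+\hat r$ over all choices of probability distributions $\theta(\cdot,x)$ on $\mathcal A(x)$ for each $x\in\mathcal X$, and of conditional distributions, given $Y(t)=y$, of random vectors $\boldsymbol Z(t)\in\{0,1\}^K$, $\boldsymbol P(t)\in\mathcal P_1\times\cdots\times\mathcal P_K$ for each $y\in\mathcal Y$, subject to $\hat a_m\ge\hat\mu_m$ for all $m$, where $\hat c=\sum_x\pi(x)\sum_{\boldsymbol a\in\mathcal A(x)}\theta(\boldsymbol a,x)c(\boldsymbol a,x)$, $\hat a_m=\sum_x\pi(x)\sum_{\boldsymbol a\in\mathcal A(x)}\theta(\boldsymbol a,x)a_m$, $\hat r=\sum_y\pi(y)\sum_k\mathbb{E}\{Z_k(t)(P_k(t)-\alpha_k)F_k(P_k(t),y)\mid Y(t)=y\}$, $\hat\mu_m=\sum_y\pi(y)\sum_k\beta_{mk}\mathbb{E}\{Z_k(t)F_k(P_k(t),y)\mid Y(t)=y\}$. **The reference policy $*$.** An $(X,Y)$-only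 policy chooses $\boldsymbol A(t)\in\mathcal A(X(t))$, $\boldsymbol Z(t)$, $\boldsymbol P(t)$ as a stationary randomized function of the current $X(t),Y(t)$ only. $\boldsymbol A^*(t),\boldsymbol Z^*(t),\boldsymbol P^*(t)$ denote the decisions of a fixed $(X,Y)$-only policy which, when $X(t),Y(t)$ are distributed according to $\pi(x),\pi(y)$, satisfies $\mathbb{E}\{\phi^*(t)\}=\phi^{opt}$ and $\mathbb{E}\{A_m^*(t)\}=\sum_k\beta_{mk}\mathbb{E}\{Z_k^*(t)F_k(P_k^*(t),Y(t))\}$ for all $m$. Here $\phi^*(t)$ is the profit of this policy when all demands are fulfilled, whose (conditional) expectation is that of $-c(\boldsymbol A^*(t),X(t))+\sum_kZ_k^*(t)(P_k^*(t)-\alpha_k)F_k(P_k^*(t),Y(t))$. **History and decaying memory.** $H(t)=\{X(\tau),Y(\tau)\}_{\tau=0}^{t-1}\cup\{[Q_m(\tau)]_{m=1}^M\}_{\tau=0}^t$. The processes $X(t),Y(t)$ have the *decaying memory property* if for every small $\epsilon>0$ there is a positive integer $T=T_\epsilon$ such that the two displayed inequalities in the claim involving $\epsilon$ and $T$ hold for every $t_0$ and every $H(t_0)$. $O(V)$ is with all parameters other than $V$ held fixed. *)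

theory Defs
  imports "HOL-Probability.Probability" "HOL-Library.Landau_Symbols"
begin

text \<open>Materials and products are the elements of the finite types \<open>'m\<close> and \<open>'k\<close>. A supply
  state is the pair of the vector of unit prices and the vector of available amounts.\<close>

type_synonym 'm supply_state = "('m \<Rightarrow> real) \<times> ('m \<Rightarrow> real)"

record ('m, 'k, 'y) plant =
  beta :: "'m \<Rightarrow> 'k \<Rightarrow> nat"
  alpha :: "'k \<Rightarrow> real"
  Amax :: "'m \<Rightarrow> real"
  cmax :: real
  supply_states :: "'m supply_state set"
  demand_states :: "'y set"
  price_set :: "'k \<Rightarrow> real set"
  Dmax :: "'k \<Rightarrow> nat"
  demand_law :: "'k \<Rightarrow> real \<Rightarrow> 'y \<Rightarrow> nat pmf"

definition purchase_cost :: "('m::finite \<Rightarrow> nat) \<Rightarrow> 'm supply_state \<Rightarrow> real" where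
  "purchase_cost a x = (\<Sum>m\<in>UNIV. fst x m * real (a m))"

definition purchases :: "('m::finite, 'k, 'y) plant \<Rightarrow> 'm supply_state \<Rightarrow> ('m \<Rightarrow> nat) set" where
  "purchases pl x =
     {a. (\<forall>m. real (a m) \<le> min (Amax pl m) (snd x m)) \<and> purchase_cost a x \<le> cmax pl}"

definition mean_demand :: "('m, 'k, 'y) plant \<Rightarrow> 'k \<Rightarrow> real \<Rightarrow> 'y \<Rightarrow> real" where
  "mean_demand pl k p y = measure_pmf.expectation (demand_law pl k p y) real"

definition mu_max :: "('m, 'k::finite, 'y) plant \<Rightarrow> 'm \<Rightarrow> real" where
  "mu_max pl m = (\<Sum>k\<in>UNIV. real (beta pl m k) * real (Dmax pl k))"

text \<open>The price sets are compact and nonempty, so this supremum is a maximum.\<close>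

definition Pmax :: "('m, 'k, 'y) plant \<Rightarrow> 'k \<Rightarrow> real" where
  "Pmax pl k = Sup (price_set pl k)"

definition valid_plant :: "('m::finite, 'k::finite, 'y) plant \<Rightarrow> bool" where
  "valid_plant pl \<longleftrightarrow>
     (\<forall>m. \<exists>k. beta pl m k > 0) \<and>
     (\<forall>k. alpha pl k \<ge> 0) \<and>
     (\<forall>m. Amax pl m \<ge> 0) \<and> cmax pl \<ge> 0 \<and>
     countable (supply_states pl) \<and> countable (demand_states pl) \<and>
     (\<forall>x\<in>supply_states pl. \<forall>m. fst x m \<ge> 0 \<and> snd x m \<ge> 0) \<and>
     (\<forall>k. compact (price_set pl k) \<and> price_set pl k \<noteq> {} \<and> price_set pl k \<subseteq> {0..}) \<and>
     (\<forall>k. \<forall>p\<in>price_set pl k. \<forall>y\<in>demand_states pl. set_pmf (demand_law pl k p y) \<subseteq> {..Dmax pl k}) \<and>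
     (\<forall>k. \<forall>y\<in>demand_states pl. continuous_on (price_set pl k) (\<lambda>p. mean_demand pl k p y))"


section \<open>Sample paths of the plant\<close>

text \<open>All processes take the slot as first and the sample point as second argument.
  \<open>sold\<close> is the number of units of each product actually sold.\<close>

record ('w, 'm, 'k, 'y) run =
  sstate :: "nat \<Rightarrow> 'w \<Rightarrow> 'm supply_state"
  dstate :: "nat \<Rightarrow> 'w \<Rightarrow> 'y"
  inventory :: "nat \<Rightarrow> 'w \<Rightarrow> 'm \<Rightarrow> int"
  purchase :: "nat \<Rightarrow> 'w \<Rightarrow> 'm \<Rightarrow> nat"
  offered :: "nat \<Rightarrow> 'w \<Rightarrow> 'k \<Rightarrow> bool"
  price :: "nat \<Rightarrow> 'w \<Rightarrow> 'k \<Rightarrow> real"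
  demand :: "nat \<Rightarrow> 'w \<Rightarrow> 'k \<Rightarrow> nat"
  sold :: "nat \<Rightarrow> 'w \<Rightarrow> 'k \<Rightarrow> nat"

text \<open>What is known when the demands of slot \<open>t\<close> are drawn, together with the whole exogenous
  processes: inventories and decisions up to slot \<open>t\<close>, demands and sales before slot \<open>t\<close>. Except
  for prices, all variables are countably valued, so their level sets generate.\<close>

definition past :: "'w measure \<Rightarrow> ('w, 'm, 'k, 'y) run \<Rightarrow> nat \<Rightarrow> 'w measure" where
  "past \<Omega> r t = sigma (space \<Omega>)
     ({sstate r \<tau> -` {x} \<inter> space \<Omega> | \<tau> x. True} \<union>
      {dstate r \<tau> -` {y} \<inter> space \<Omega> | \<tau> y. True} \<union>
      {inventory r \<tau> -` {q} \<inter> space \<Omega> | \<tau> q. \<tau> \<le> t} \<union>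
      {purchase r \<tau> -` {a} \<inter> space \<Omega> | \<tau> a. \<tau> \<le> t} \<union>
      {offered r \<tau> -` {z} \<inter> space \<Omega> | \<tau> z. \<tau> \<le> t} \<union>
      {(\<lambda>\<omega>. price r \<tau> \<omega> k) -` S \<inter> space \<Omega> | \<tau> k S. \<tau> \<le> t \<and> S \<in> sets borel} \<union>
      {demand r \<tau> -` {d} \<inter> space \<Omega> | \<tau> d. \<tau> < t} \<union>
      {sold r \<tau> -` {d} \<inter> space \<Omega> | \<tau> d. \<tau> < t})"

text \<open>The \<open>\<sigma>\<close>-algebra of the history \<open>H(t)\<close>.\<close>

definition history :: "'w measure \<Rightarrow> ('w, 'm, 'k, 'y) run \<Rightarrow> nat \<Rightarrow> 'w measure" where
  "history \<Omega> r t = sigma (space \<Omega>)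
     ({sstate r \<tau> -` {x} \<inter> space \<Omega> | \<tau> x. \<tau> < t} \<union>
      {dstate r \<tau> -` {y} \<inter> space \<Omega> | \<tau> y. \<tau> < t} \<union>
      {inventory r \<tau> -` {q} \<inter> space \<Omega> | \<tau> q. \<tau> \<le> t})"

definition plant_run ::
    "'w measure \<Rightarrow> ('m::finite, 'k::finite, 'y) plant \<Rightarrow> ('w, 'm, 'k, 'y) run \<Rightarrow> bool" where
  "plant_run \<Omega> pl r \<longleftrightarrow>
     (\<forall>t. sstate r t \<in> \<Omega> \<rightarrow>\<^sub>M count_space (supply_states pl)) \<and>
     (\<forall>t. dstate r t \<in> \<Omega> \<rightarrow>\<^sub>M count_space (demand_states pl)) \<and>
     (\<forall>t. inventory r t \<in> \<Omega> \<rightarrow>\<^sub>M count_space UNIV) \<and>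
     (\<forall>t. purchase r t \<in> \<Omega> \<rightarrow>\<^sub>M count_space UNIV) \<and>
     (\<forall>t. offered r t \<in> \<Omega> \<rightarrow>\<^sub>M count_space UNIV) \<and>
     (\<forall>t k. (\<lambda>\<omega>. price r t \<omega> k) \<in> borel_measurable \<Omega>) \<and>
     (\<forall>t. demand r t \<in> \<Omega> \<rightarrow>\<^sub>M count_space UNIV) \<and>
     (\<forall>t. sold r t \<in> \<Omega> \<rightarrow>\<^sub>M count_space UNIV) \<and>
     (\<forall>t. \<forall>\<omega>\<in>space \<Omega>.
        purchase r t \<omega> \<in> purchases pl (sstate r t \<omega>) \<and>
        (\<forall>k. price r t \<omega> k \<in> price_set pl k) \<and>
        (\<forall>k. demand r t \<omega> k \<le> Dmax pl k) \<and>
        (\<forall>m. inventory r (Suc t) \<omega> m =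
           max (inventory r t \<omega> m - (\<Sum>k\<in>UNIV. int (beta pl m k) * int (sold r t \<omega> k))) 0
             + int (purchase r t \<omega> m))) \<and>
     (\<forall>t k d. AE \<omega> in \<Omega>.
        real_cond_exp \<Omega> (past \<Omega> r t) (\<lambda>\<omega>'. of_bool (demand r t \<omega>' k = d)) \<omega>
          = pmf (demand_law pl k (price r t \<omega> k) (dstate r t \<omega>)) d)"

definition phi_actual ::
    "('m::finite, 'k::finite, 'y) plant \<Rightarrow> ('w, 'm, 'k, 'y) run \<Rightarrow> nat \<Rightarrow> 'w \<Rightarrow> real" where
  "phi_actual pl r t \<omega> =
     - purchase_cost (purchase r t \<omega>) (sstate r t \<omega>)
     + (\<Sum>k\<in>UNIV. of_bool (offered r t \<omega> k) * real (sold r t \<omega> k) * (price r t \<omega> k - alpha pl k))"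

definition time_averages ::
    "'w measure \<Rightarrow> ('m, 'k, 'y) plant \<Rightarrow> ('w, 'm, 'k, 'y) run \<Rightarrow> 'm supply_state pmf \<Rightarrow> 'y pmf \<Rightarrow> bool" where
  "time_averages \<Omega> pl r \<pi>x \<pi>y \<longleftrightarrow>
     set_pmf \<pi>x \<subseteq> supply_states pl \<and> set_pmf \<pi>y \<subseteq> demand_states pl \<and>
     (\<forall>x\<in>supply_states pl. AE \<omega> in \<Omega>.
        (\<lambda>t. (\<Sum>\<tau><t. of_bool (sstate r \<tau> \<omega> = x)) / real t) \<longlonglongrightarrow> pmf \<pi>x x) \<and>
     (\<forall>y\<in>demand_states pl. AE \<omega> in \<Omega>.
        (\<lambda>t. (\<Sum>\<tau><t. of_bool (dstate r \<tau> \<omega> = y)) / real t) \<longlonglongrightarrow> pmf \<pi>y y)"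


section \<open>The joint purchasing and pricing algorithm\<close>

definition jpp_blocked :: "('m, 'k::finite, 'y) plant \<Rightarrow> ('m \<Rightarrow> int) \<Rightarrow> 'k \<Rightarrow> bool" where
  "jpp_blocked pl q k \<longleftrightarrow> (\<exists>m. beta pl m k > 0 \<and> of_int (q m) < mu_max pl m)"

definition jpp_purchase_obj ::
    "real \<Rightarrow> ('m::finite \<Rightarrow> real) \<Rightarrow> ('m \<Rightarrow> int) \<Rightarrow> 'm supply_state \<Rightarrow> ('m \<Rightarrow> nat) \<Rightarrow> real" where
  "jpp_purchase_obj V \<theta> q x a =
     V * purchase_cost a x + (\<Sum>m\<in>UNIV. real (a m) * (of_int (q m) - \<theta> m))"

definition jpp_price_obj ::
    "('m::finite, 'k, 'y) plant \<Rightarrow> real \<Rightarrow> ('m \<Rightarrow> real) \<Rightarrow> ('m \<Rightarrow> int) \<Rightarrow> 'y \<Rightarrow> 'k \<Rightarrow> real \<Rightarrow> real" where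
  "jpp_price_obj pl V \<theta> q y k p =
     V * (p - alpha pl k) * mean_demand pl k p y
     + mean_demand pl k p y * (\<Sum>m\<in>UNIV. real (beta pl m k) * (of_int (q m) - \<theta> m))"

text \<open>\<open>ra\<close> and \<open>rp\<close> are the fixed selection rules for minimizers and maximizers. The price of a
  blocked product has no effect and is only required to be admissible. That the assignment of
  \<open>sold\<close> is possible, i.e. that the truncation in the queue dynamics is never active, is
  lemma \<open>jpp_queue_update\<close> below.\<close>

definition follows_jpp ::
    "'w measure \<Rightarrow> ('m::finite, 'k::finite, 'y) plant \<Rightarrow> real \<Rightarrow> ('m \<Rightarrow> real) \<Rightarrow>
     ('w, 'm, 'k, 'y) run \<Rightarrow> bool" where
  "follows_jpp \<Omega> pl V \<theta> r \<longleftrightarrow>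
     (\<exists>ra rp.
        (\<forall>q. \<forall>x\<in>supply_states pl. \<forall>y\<in>demand_states pl.
           is_arg_min (jpp_purchase_obj V \<theta> q x) (\<lambda>a. a \<in> purchases pl x) (ra q x y) \<and>
           (\<forall>k. rp q x y k \<in> price_set pl k) \<and>
           (\<forall>k. \<not> jpp_blocked pl q k \<longrightarrow>
              is_arg_max (jpp_price_obj pl V \<theta> q y k) (\<lambda>p. p \<in> price_set pl k) (rp q x y k))) \<and>
        (\<forall>t. \<forall>\<omega>\<in>space \<Omega>.
           purchase r t \<omega> = ra (inventory r t \<omega>) (sstate r t \<omega>) (dstate r t \<omega>) \<and>
           price r t \<omega> = rp (inventory r t \<omega>) (sstate r t \<omega>) (dstate r t \<omega>) \<and>
           (\<forall>k. offered r t \<omega> k \<longleftrightarrow>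
              \<not> jpp_blocked pl (inventory r t \<omega>) k \<and>
              jpp_price_obj pl V \<theta> (inventory r t \<omega>) (dstate r t \<omega>) k (price r t \<omega> k) > 0) \<and>
           (\<forall>k. sold r t \<omega> k = of_bool (offered r t \<omega> k) * demand r t \<omega> k)))"

definition theta :: "('m::finite, 'k::finite, 'y) plant \<Rightarrow> real \<Rightarrow> 'm \<Rightarrow> real" where
  "theta pl V m = Max ((\<lambda>k.
       V * (Pmax pl k - alpha pl k) / real (beta pl m k)
       + (\<Sum>i\<in>UNIV - {m}. real (beta pl i k) * Amax pl i / real (beta pl m k))
       + 2 * mu_max pl m) ` {k. beta pl m k > 0})"

definition Qmax :: "('m::finite, 'k::finite, 'y) plant \<Rightarrow> real \<Rightarrow> 'm \<Rightarrow> real" where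
  "Qmax pl V m = theta pl V m + Amax pl m"

lemma jpp_queue_update:
  assumes run: "plant_run \<Omega> pl r" and jpp: "follows_jpp \<Omega> pl V \<theta> r"
    and \<omega>: "\<omega> \<in> space \<Omega>" and nonneg: "inventory r t \<omega> m \<ge> 0"
  shows "inventory r (Suc t) \<omega> m =
    inventory r t \<omega> m
      - (\<Sum>k\<in>UNIV. int (beta pl m k) * of_bool (offered r t \<omega> k) * int (demand r t \<omega> k))
      + int (purchase r t \<omega> m)"
proof -
  let ?S = "\<Sum>k\<in>UNIV. int (beta pl m k) * int (sold r t \<omega> k)"
  from jpp \<omega> have sold: "\<And>k. sold r t \<omega> k = of_bool (offered r t \<omega> k) * demand r t \<omega> k"
    and off: "\<And>k. offered r t \<omega> k \<Longrightarrow> \<not> jpp_blocked pl (inventory r t \<omega>) k"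
    unfolding follows_jpp_def by blast+
  from run \<omega> have D: "\<And>k. demand r t \<omega> k \<le> Dmax pl k"
    and step: "inventory r (Suc t) \<omega> m =
      max (inventory r t \<omega> m - ?S) 0 + int (purchase r t \<omega> m)"
    unfolding plant_run_def by blast+
  have "?S \<le> inventory r t \<omega> m"
  proof (cases "\<exists>k. beta pl m k > 0 \<and> offered r t \<omega> k")
    case True
    then obtain k where "beta pl m k > 0" "offered r t \<omega> k" by blast
    with off[of k] have "mu_max pl m \<le> of_int (inventory r t \<omega> m)"
      unfolding jpp_blocked_def by (meson not_le)
    moreover have "real_of_int ?S \<le> mu_max pl m"
      unfolding mu_max_def of_int_sum
      by (intro sum_mono) (auto simp: sold intro!: mult_left_mono D)
    ultimately show ?thesis by linarith
  next
    case False
    then have "?S = 0" by (intro sum.neutral) (auto simp: sold)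
    with nonneg show ?thesis by simp
  qed
  moreover have "?S = (\<Sum>k\<in>UNIV. int (beta pl m k) * of_bool (offered r t \<omega> k) * int (demand r t \<omega> k))"
    by (simp add: sold mult.assoc)
  ultimately show ?thesis using step by simp
qed


section \<open>Optimal profit and reference policy\<close>

text \<open>The components of the price space are restricted to the price sets because mean demand
  is continuous, hence measurable, only there.\<close>

definition pricing_space :: "('m, 'k::finite, 'y) plant \<Rightarrow> (('k \<Rightarrow> bool) \<times> ('k \<Rightarrow> real)) measure" where
  "pricing_space pl = count_space UNIV \<Otimes>\<^sub>M (\<Pi>\<^sub>M k\<in>UNIV. restrict_space borel (price_set pl k))"

definition opt_cost ::
    "'m::finite supply_state pmf \<Rightarrow> ('m supply_state \<Rightarrow> ('m \<Rightarrow> nat) pmf) \<Rightarrow> real" where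
  "opt_cost \<pi>x \<eta> = measure_pmf.expectation \<pi>x
     (\<lambda>x. measure_pmf.expectation (\<eta> x) (\<lambda>a. purchase_cost a x))"

definition opt_purchase ::
    "'m supply_state pmf \<Rightarrow> ('m supply_state \<Rightarrow> ('m \<Rightarrow> nat) pmf) \<Rightarrow> 'm \<Rightarrow> real" where
  "opt_purchase \<pi>x \<eta> m = measure_pmf.expectation \<pi>x
     (\<lambda>x. measure_pmf.expectation (\<eta> x) (\<lambda>a. real (a m)))"

definition opt_revenue ::
    "('m, 'k::finite, 'y) plant \<Rightarrow> 'y pmf \<Rightarrow> ('y \<Rightarrow> (('k \<Rightarrow> bool) \<times> ('k \<Rightarrow> real)) measure) \<Rightarrow> real" where
  "opt_revenue pl \<pi>y \<nu> = measure_pmf.expectation \<pi>y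
     (\<lambda>y. \<Sum>k\<in>UNIV. \<integral>(z, p). of_bool (z k) * (p k - alpha pl k) * mean_demand pl k (p k) y \<partial>\<nu> y)"

definition opt_consumption ::
    "('m, 'k::finite, 'y) plant \<Rightarrow> 'y pmf \<Rightarrow> ('y \<Rightarrow> (('k \<Rightarrow> bool) \<times> ('k \<Rightarrow> real)) measure) \<Rightarrow>
     'm \<Rightarrow> real" where
  "opt_consumption pl \<pi>y \<nu> m = measure_pmf.expectation \<pi>y
     (\<lambda>y. \<Sum>k\<in>UNIV. real (beta pl m k) *
        (\<integral>(z, p). of_bool (z k) * mean_demand pl k (p k) y \<partial>\<nu> y))"

definition attainable_profits ::
    "('m::finite, 'k::finite, 'y) plant \<Rightarrow> 'm supply_state pmf \<Rightarrow> 'y pmf \<Rightarrow> real set" where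
  "attainable_profits pl \<pi>x \<pi>y =
     {- opt_cost \<pi>x \<eta> + opt_revenue pl \<pi>y \<nu> | \<eta> \<nu>.
        (\<forall>x\<in>supply_states pl. set_pmf (\<eta> x) \<subseteq> purchases pl x) \<and>
        (\<forall>y\<in>demand_states pl. \<nu> y \<in> space (prob_algebra (pricing_space pl))) \<and>
        (\<forall>m. opt_purchase \<pi>x \<eta> m \<ge> opt_consumption pl \<pi>y \<nu> m)}"

definition is_optimal_profit ::
    "('m::finite, 'k::finite, 'y) plant \<Rightarrow> 'm supply_state pmf \<Rightarrow> 'y pmf \<Rightarrow> real \<Rightarrow> bool" where
  "is_optimal_profit pl \<pi>x \<pi>y \<phi>opt \<longleftrightarrow>
     \<phi>opt \<in> attainable_profits pl \<pi>x \<pi>y \<and> (\<forall>v\<in>attainable_profits pl \<pi>x \<pi>y. v \<le> \<phi>opt)"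

type_synonym ('m, 'k) decision = "('m \<Rightarrow> nat) \<times> ('k \<Rightarrow> bool) \<times> ('k \<Rightarrow> real)"

definition decision_space :: "('m, 'k::finite, 'y) plant \<Rightarrow> ('m, 'k) decision measure" where
  "decision_space pl = count_space UNIV \<Otimes>\<^sub>M pricing_space pl"

fun mean_profit ::
    "('m::finite, 'k::finite, 'y) plant \<Rightarrow> 'm supply_state \<Rightarrow> 'y \<Rightarrow> ('m, 'k) decision \<Rightarrow> real" where
  "mean_profit pl x y (a, z, p) =
     - purchase_cost a x
     + (\<Sum>k\<in>UNIV. of_bool (z k) * (p k - alpha pl k) * mean_demand pl k (p k) y)"

fun mean_surplus ::
    "('m, 'k::finite, 'y) plant \<Rightarrow> 'y \<Rightarrow> 'm \<Rightarrow> ('m, 'k) decision \<Rightarrow> real" where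
  "mean_surplus pl y m (a, z, p) =
     real (a m) - (\<Sum>k\<in>UNIV. real (beta pl m k) * of_bool (z k) * mean_demand pl k (p k) y)"

text \<open>An \<open>(X,Y)\<close>-only policy \<open>\<kappa>\<close> assigns to each pair of states a distribution of decisions.\<close>

definition xy_policy ::
    "('m::finite, 'k::finite, 'y) plant \<Rightarrow> ('m supply_state \<Rightarrow> 'y \<Rightarrow> ('m, 'k) decision measure) \<Rightarrow> bool" where
  "xy_policy pl \<kappa> \<longleftrightarrow>
     (\<forall>x\<in>supply_states pl. \<forall>y\<in>demand_states pl.
        \<kappa> x y \<in> space (prob_algebra (decision_space pl)) \<and>
        (AE w in \<kappa> x y. fst w \<in> purchases pl x))"

text \<open>Only the marginals \<open>\<pi>x\<close>, \<open>\<pi>y\<close> of the stationary state distribution are given; the joint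
  distribution \<open>J\<close> may be any coupling of them.\<close>

definition optimal_xy_policy ::
    "('m::finite, 'k::finite, 'y) plant \<Rightarrow> 'm supply_state pmf \<Rightarrow> 'y pmf \<Rightarrow> real \<Rightarrow>
     ('m supply_state \<Rightarrow> 'y \<Rightarrow> ('m, 'k) decision measure) \<Rightarrow> bool" where
  "optimal_xy_policy pl \<pi>x \<pi>y \<phi>opt \<kappa> \<longleftrightarrow>
     xy_policy pl \<kappa> \<and>
     (\<exists>J. map_pmf fst J = \<pi>x \<and> map_pmf snd J = \<pi>y \<and>
        measure_pmf.expectation J (\<lambda>(x, y). \<integral>w. mean_profit pl x y w \<partial>\<kappa> x y) = \<phi>opt \<and>
        (\<forall>m. measure_pmf.expectation J (\<lambda>(x, y). \<integral>(a, z, p). real (a m) \<partial>\<kappa> x y) =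
           (\<Sum>k\<in>UNIV. real (beta pl m k) *
              measure_pmf.expectation J
                (\<lambda>(x, y). \<integral>(a, z, p). of_bool (z k) * mean_demand pl k (p k) y \<partial>\<kappa> x y))))"

text \<open>\<open>W t\<close> is the decision triple of the policy \<open>\<kappa>\<close> in slot \<open>t\<close>, made with the actual states
  and with randomization not depending on anything else.\<close>

definition xy_decisions ::
    "'w measure \<Rightarrow> ('m::finite, 'k::finite, 'y) plant \<Rightarrow> ('w, 'm, 'k, 'y) run \<Rightarrow>
     ('m supply_state \<Rightarrow> 'y \<Rightarrow> ('m, 'k) decision measure) \<Rightarrow> (nat \<Rightarrow> 'w \<Rightarrow> ('m, 'k) decision) \<Rightarrow> bool" where
  "xy_decisions \<Omega> pl r \<kappa> W \<longleftrightarrow>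
     (\<forall>t. W t \<in> \<Omega> \<rightarrow>\<^sub>M decision_space pl) \<and>
     (\<forall>t. \<forall>\<omega>\<in>space \<Omega>. fst (W t \<omega>) \<in> purchases pl (sstate r t \<omega>)) \<and>
     (\<forall>t. \<forall>S\<in>sets (decision_space pl). AE \<omega> in \<Omega>.
        real_cond_exp \<Omega> (past \<Omega> r t) (\<lambda>\<omega>'. of_bool (W t \<omega>' \<in> S)) \<omega>
          = measure (\<kappa> (sstate r t \<omega>) (dstate r t \<omega>)) S)"

text \<open>The profit of the reference policy enters only through conditional expectations, for which
  demands may be replaced by their means.\<close>

definition phi_star ::
    "('m::finite, 'k::finite, 'y) plant \<Rightarrow> ('w, 'm, 'k, 'y) run \<Rightarrow>
     (nat \<Rightarrow> 'w \<Rightarrow> ('m, 'k) decision) \<Rightarrow> nat \<Rightarrow> 'w \<Rightarrow> real" where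
  "phi_star pl r W t \<omega> = mean_profit pl (sstate r t \<omega>) (dstate r t \<omega>) (W t \<omega>)"

definition surplus_star ::
    "('m, 'k::finite, 'y) plant \<Rightarrow> ('w, 'm, 'k, 'y) run \<Rightarrow>
     (nat \<Rightarrow> 'w \<Rightarrow> ('m, 'k) decision) \<Rightarrow> 'm \<Rightarrow> nat \<Rightarrow> 'w \<Rightarrow> real" where
  "surplus_star pl r W m t \<omega> = mean_surplus pl (dstate r t \<omega>) m (W t \<omega>)"

definition memory_bound ::
    "'w measure \<Rightarrow> ('m::finite, 'k::finite, 'y) plant \<Rightarrow> ('w, 'm, 'k, 'y) run \<Rightarrow>
     (nat \<Rightarrow> 'w \<Rightarrow> ('m, 'k) decision) \<Rightarrow> real \<Rightarrow> real \<Rightarrow> nat \<Rightarrow> bool" where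
  "memory_bound \<Omega> pl r W \<phi>opt \<epsilon> T \<longleftrightarrow>
     (\<forall>t0.
        (AE \<omega> in \<Omega>. \<bar>\<phi>opt - (1 / real T) *
            (\<Sum>\<tau>=t0..<t0+T. real_cond_exp \<Omega> (history \<Omega> r t0) (phi_star pl r W \<tau>) \<omega>)\<bar> \<le> \<epsilon>) \<and>
        (\<forall>m. AE \<omega> in \<Omega>. \<bar>(1 / real T) *
            (\<Sum>\<tau>=t0..<t0+T. real_cond_exp \<Omega> (history \<Omega> r t0) (surplus_star pl r W m \<tau>) \<omega>)\<bar> \<le> \<epsilon>))"

definition decaying_memory ::
    "'w measure \<Rightarrow> ('m::finite, 'k::finite, 'y) plant \<Rightarrow> ('w, 'm, 'k, 'y) run \<Rightarrow>
     (nat \<Rightarrow> 'w \<Rightarrow> ('m, 'k) decision) \<Rightarrow> real \<Rightarrow> bool" where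
  "decaying_memory \<Omega> pl r W \<phi>opt \<longleftrightarrow> (\<forall>\<epsilon>>0. \<exists>T>0. memory_bound \<Omega> pl r W \<phi>opt \<epsilon> T)"

definition drift_const :: "('m::finite, 'k::finite, 'y) plant \<Rightarrow> real" where
  "drift_const pl = (1 / 2) * (\<Sum>m\<in>UNIV. max ((Amax pl m)\<^sup>2) ((mu_max pl m)\<^sup>2))"

end

theory Submission
  imports Defs
begin

text \<open>
  The inventory bounds hold on every sample path, by induction over the slots. Above the threshold
  \<open>theta\<close> a material has positive weight in the purchasing objective and is not bought, so its
  inventory exceeds the threshold by one purchase at most (\<open>no_purchase_above_threshold\<close>). The
  threshold is so large that, with fewer than \<open>2 * mu_max\<close> units of a material in stock, every
  product using it has a nonpositive pricing objective at all prices and is not sold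
  (\<open>not_offered_when_scarce\<close>). With more units in stock, one slot cannot take the inventory below
  \<open>mu_max\<close>.

  The profit bound is a Lyapunov drift argument. Consider half the sum of the squared deviations of
  the inventories from the thresholds, here called \<open>excess\<close>. Its change during a slot, minus \<open>V\<close>
  times the profit of that slot, is at most \<open>drift_const\<close> plus an expression in the current
  decisions (\<open>drift_minus_profit\<close>). Once the demands in this expression are replaced by their
  conditional means (\<open>expectation_demand\<close>), it is exactly what the algorithm minimizes. The lower
  inventory bound implies that no product is ever blocked, so the minimum is over all admissible
  decisions, and those of the reference policy may be inserted on each sample path
  (\<open>jpp_minimizes_drift_bound\<close>). This gives minus \<open>V\<close> times the reference profit plus the products
  of the excesses with the surpluses of the reference policy.

  The surpluses have small mean only over \<open>T\<close> slots, conditionally on the history. In a block of \<open>T\<close>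
  slots, the excess is therefore replaced by its value at the beginning of the block, which the
  history determines. As the excess changes by a bounded amount per slot, this costs an error of
  order \<open>T\<^sup>2\<close> (\<open>excess_surplus_block\<close>). Summing over blocks telescopes the Lyapunov function, which is
  nonnegative, and dividing by the number of slots yields the claim
  (\<open>liminf_average_ge_of_block_bounds\<close>).
\<close>


section \<open>Long-run averages of sequences with telescoping block bounds\<close>

text \<open>Summing the block bound over consecutive blocks telescopes \<open>L\<close>, so that the partial sums
  up to a multiple of \<open>T\<close> exceed the linear function of slope \<open>b\<close> up to a constant. An
  incomplete last block changes them by a bounded amount.\<close>

lemma liminf_average_ge_of_block_bounds:
  fixes f L :: "nat \<Rightarrow> real"
  assumes T: "T > 0" and bdd: "\<And>t. \<bar>f t\<bar> \<le> C" and L: "\<And>t. L t \<ge> 0"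
    and block: "\<And>t. (\<Sum>\<tau>=t..<t+T. f \<tau>) \<ge> real T * b + (L (t + T) - L t)"
  shows "liminf (\<lambda>t. ereal ((1 / real t) * (\<Sum>\<tau><t. f \<tau>))) \<ge> ereal b"
proof -
  have C: "C \<ge> 0" using bdd[of 0] by linarith
  have blocks: "(\<Sum>\<tau><n * T. f \<tau>) \<ge> real n * real T * b + (L (n * T) - L 0)" for n
  proof (induction n)
    case (Suc n)
    have "{..<Suc n * T} = {..<n * T} \<union> {n * T..<n * T + T}" by auto
    then have "(\<Sum>\<tau><Suc n * T. f \<tau>) = (\<Sum>\<tau><n * T. f \<tau>) + (\<Sum>\<tau>=n * T..<n * T + T. f \<tau>)"
      by (metis (no_types, lifting) finite_atLeastLessThan finite_lessThan ivl_disj_int_one(2)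
          sum.union_disjoint)
    with Suc.IH block[of "n * T"] show ?case by (simp add: algebra_simps)
  qed simp
  \<comment> \<open>The initial value of \<open>L\<close>, the error from rounding \<open>t\<close> down to a multiple of \<open>T\<close> in the
    linear term, and the terms of the incomplete block.\<close>
  define K where "K = L 0 + real T * \<bar>b\<bar> + real T * C"
  have sums: "(\<Sum>\<tau><t. f \<tau>) \<ge> real t * b - K" for t
  proof -
    define n where "n = t div T"
    have t: "n * T \<le> t" and r: "t - n * T \<le> T"
      using T by (auto simp: n_def minus_div_mult_eq_mod intro: less_imp_le)
    have rest: "\<bar>\<Sum>\<tau>=n * T..<t. f \<tau>\<bar> \<le> real T * C"
    proof -
      have "\<bar>\<Sum>\<tau>=n * T..<t. f \<tau>\<bar> \<le> (\<Sum>\<tau>=n * T..<t. C)"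
        by (rule order_trans[OF sum_abs]) (intro sum_mono bdd)
      also have "\<dots> \<le> real T * C" using r C by (simp add: mult_right_mono del: of_nat_diff)
      finally show ?thesis .
    qed
    have "\<bar>(real t - real n * real T) * b\<bar> \<le> real T * \<bar>b\<bar>"
    proof -
      have "\<bar>real t - real n * real T\<bar> = real (t - n * T)" using t by (simp add: of_nat_diff flip: of_nat_mult)
      then show ?thesis using r by (simp add: abs_mult mult_right_mono)
    qed
    then have "real n * real T * b \<ge> real t * b - real T * \<bar>b\<bar>" by (simp add: algebra_simps abs_le_iff)
    moreover have "(\<Sum>\<tau><t. f \<tau>) = (\<Sum>\<tau><n * T. f \<tau>) + (\<Sum>\<tau>=n * T..<t. f \<tau>)"
      using sum.atLeastLessThan_concat[of 0 "n * T" t f] t by (simp add: lessThan_atLeast0)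
    ultimately show ?thesis using blocks[of n] L[of "n * T"] rest unfolding K_def by linarith
  qed
  have "(\<lambda>t. b - K / real t) \<longlonglongrightarrow> b - 0"
    by (intro tendsto_diff tendsto_const lim_const_over_n)
  then have "(\<lambda>t. ereal (b - K / real t)) \<longlonglongrightarrow> ereal b" by simp
  then have "ereal b = liminf (\<lambda>t. ereal (b - K / real t))"
    by (intro lim_imp_Liminf[symmetric]) auto
  also have "\<dots> \<le> liminf (\<lambda>t. ereal ((1 / real t) * (\<Sum>\<tau><t. f \<tau>)))"
  proof (rule Liminf_mono, rule eventually_sequentiallyI[of 1])
    fix t :: nat assume "1 \<le> t"
    then have "b - K / real t = (1 / real t) * (real t * b - K)" by (simp add: field_simps)
    also have "\<dots> \<le> (1 / real t) * (\<Sum>\<tau><t. f \<tau>)"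
      by (intro mult_left_mono sums) simp
    finally show "ereal (b - K / real t) \<le> ereal ((1 / real t) * (\<Sum>\<tau><t. f \<tau>))" by simp
  qed
  finally show ?thesis .
qed


section \<open>Bounds on the parameters of a plant\<close>

lemma finite_nonempty_uses:
  assumes "valid_plant pl"
  shows "finite {k. beta pl m k > 0}" "{k. beta pl m k > 0} \<noteq> {}"
  using assms by (auto simp: valid_plant_def)

text \<open>For every \<open>v\<close> the threshold is one of finitely many affine functions of \<open>v\<close>.\<close>

lemma Qmax_bigo:
  fixes pl :: "('m::finite, 'k::finite, 'y) plant"
  assumes "valid_plant pl"
  shows "(\<lambda>v. Qmax pl v m) \<in> O[at_top](\<lambda>v. v)"
proof -
  define S where "S = {k. beta pl m k > 0}"
  define c where "c k = (Pmax pl k - alpha pl k) / real (beta pl m k)" for k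
  define d where "d k = (\<Sum>i\<in>UNIV - {m}. real (beta pl i k) * Amax pl i / real (beta pl m k))
       + 2 * mu_max pl m" for k
  have theta: "theta pl v m = Max ((\<lambda>k. v * c k + d k) ` S)" for v
    by (simp add: theta_def S_def c_def d_def add.assoc)
  have S: "finite S" "S \<noteq> {}"
    unfolding S_def by (rule finite_nonempty_uses[OF assms])+
  have bound: "\<bar>Qmax pl v m\<bar> \<le> ((\<Sum>k\<in>S. \<bar>c k\<bar> + \<bar>d k\<bar>) + \<bar>Amax pl m\<bar>) * v" if v: "v \<ge> 1" for v
  proof -
    have "theta pl v m \<in> (\<lambda>k. v * c k + d k) ` S"
      unfolding theta using S by (intro Max_in) auto
    then obtain k where k: "k \<in> S" and th: "theta pl v m = v * c k + d k" by auto
    have "\<bar>v * c k + d k\<bar> \<le> v * \<bar>c k\<bar> + \<bar>d k\<bar>"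
      using v abs_triangle_ineq[of "v * c k" "d k"] by (simp add: abs_mult)
    also have "\<dots> \<le> v * \<bar>c k\<bar> + v * \<bar>d k\<bar>"
      using mult_right_mono[OF v, of "\<bar>d k\<bar>"] by simp
    also have "\<dots> = (\<bar>c k\<bar> + \<bar>d k\<bar>) * v" by (simp add: algebra_simps)
    also have "\<dots> \<le> (\<Sum>k\<in>S. \<bar>c k\<bar> + \<bar>d k\<bar>) * v"
      using k S v by (intro mult_right_mono member_le_sum) auto
    finally have "\<bar>theta pl v m\<bar> \<le> (\<Sum>k\<in>S. \<bar>c k\<bar> + \<bar>d k\<bar>) * v" by (simp add: th)
    moreover have "\<bar>Amax pl m\<bar> \<le> \<bar>Amax pl m\<bar> * v"
      using mult_left_mono[OF v, of "\<bar>Amax pl m\<bar>"] by simp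
    ultimately show ?thesis
      unfolding Qmax_def distrib_right by linarith
  qed
  show ?thesis
  proof (rule bigoI)
    show "\<forall>\<^sub>F v in at_top. norm (Qmax pl v m)
        \<le> ((\<Sum>k\<in>S. \<bar>c k\<bar> + \<bar>d k\<bar>) + \<bar>Amax pl m\<bar>) * norm v"
      using eventually_ge_at_top[of 1] by eventually_elim (use bound in auto)
  qed
qed

lemma mu_max_nonneg: "mu_max pl m \<ge> 0"
  by (simp add: mu_max_def sum_nonneg)

context
  fixes pl :: "('m::finite, 'k::finite, 'y) plant"
  assumes valid: "valid_plant pl"
begin

lemma Amax_nonneg: "Amax pl m \<ge> 0"
  using valid by (auto simp: valid_plant_def)

lemma alpha_nonneg: "alpha pl k \<ge> 0"
  using valid by (auto simp: valid_plant_def)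

lemma price_bounds:
  assumes "p \<in> price_set pl k"
  shows "0 \<le> p" "p \<le> Pmax pl k"
proof -
  have "compact (price_set pl k)" "price_set pl k \<subseteq> {0..}"
    using valid by (auto simp: valid_plant_def)
  with assms show "0 \<le> p" "p \<le> Pmax pl k"
    unfolding Pmax_def
    by (auto intro!: cSup_upper bounded_imp_bdd_above compact_imp_bounded)
qed

lemma demand_support:
  assumes "p \<in> price_set pl k" "y \<in> demand_states pl"
  shows "set_pmf (demand_law pl k p y) \<subseteq> {..Dmax pl k}"
  using assms valid unfolding valid_plant_def by blast

lemma mean_demand_eq_sum:
  assumes "p \<in> price_set pl k" "y \<in> demand_states pl"
  shows "mean_demand pl k p y = (\<Sum>d\<le>Dmax pl k. real d * pmf (demand_law pl k p y) d)"
  unfolding mean_demand_def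
  by (rule integral_measure_pmf_real) (use demand_support[OF assms] in auto)

lemma mean_demand_bounds:
  assumes "p \<in> price_set pl k" "y \<in> demand_states pl"
  shows "0 \<le> mean_demand pl k p y" "mean_demand pl k p y \<le> real (Dmax pl k)"
proof -
  show "0 \<le> mean_demand pl k p y"
    by (simp add: mean_demand_eq_sum[OF assms] sum_nonneg)
  have "mean_demand pl k p y
      \<le> (\<Sum>d\<le>Dmax pl k. real (Dmax pl k) * pmf (demand_law pl k p y) d)"
    unfolding mean_demand_eq_sum[OF assms] by (intro sum_mono mult_right_mono) auto
  also have "\<dots> = real (Dmax pl k)"
    using sum_pmf_eq_1[OF _ demand_support[OF assms]] by (simp flip: sum_distrib_left)
  finally show "mean_demand pl k p y \<le> real (Dmax pl k)" .
qed

lemma purchase_bounds: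
  assumes "x \<in> supply_states pl" "a \<in> purchases pl x"
  shows "real (a m) \<le> Amax pl m" "0 \<le> purchase_cost a x" "purchase_cost a x \<le> cmax pl"
  using assms valid
  by (auto simp: purchases_def purchase_cost_def valid_plant_def intro!: sum_nonneg)

text \<open>Both the amount bought and the mean amount consumed lie between zero and their maxima, so
  their difference exceeds neither maximum.\<close>

lemma mean_surplus_bound:
  assumes x: "x \<in> supply_states pl" and y: "y \<in> demand_states pl"
    and a: "a \<in> purchases pl x" and p: "\<And>k. p k \<in> price_set pl k"
  shows "\<bar>mean_surplus pl y m (a, z, p)\<bar> \<le> max (Amax pl m) (mu_max pl m)"
proof -
  let ?C = "\<Sum>k\<in>UNIV. real (beta pl m k) * of_bool (z k) * mean_demand pl k (p k) y"
  have "0 \<le> ?C" by (intro sum_nonneg) (auto simp: mean_demand_bounds[OF p y])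
  moreover have "?C \<le> mu_max pl m"
    unfolding mu_max_def
    by (intro sum_mono) (auto simp: mean_demand_bounds[OF p y] intro!: mult_left_mono)
  ultimately show ?thesis using purchase_bounds(1)[OF x a, of m] by auto
qed

lemma mean_profit_bound:
  assumes x: "x \<in> supply_states pl" and y: "y \<in> demand_states pl"
    and a: "a \<in> purchases pl x" and p: "\<And>k. p k \<in> price_set pl k"
  shows "\<bar>mean_profit pl x y (a, z, p)\<bar>
    \<le> cmax pl + (\<Sum>k\<in>UNIV. (Pmax pl k + alpha pl k) * real (Dmax pl k))"
proof -
  have "\<bar>\<Sum>k\<in>UNIV. of_bool (z k) * (p k - alpha pl k) * mean_demand pl k (p k) y\<bar>
      \<le> (\<Sum>k\<in>UNIV. (Pmax pl k + alpha pl k) * real (Dmax pl k))"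
  proof (rule order_trans[OF sum_abs sum_mono])
    fix k
    have "\<bar>p k - alpha pl k\<bar> \<le> Pmax pl k + alpha pl k"
      using price_bounds[OF p, of k] alpha_nonneg[of k] by linarith
    then have "\<bar>p k - alpha pl k\<bar> * mean_demand pl k (p k) y
        \<le> (Pmax pl k + alpha pl k) * real (Dmax pl k)"
      using mean_demand_bounds[OF p y, of k] by (intro mult_mono) auto
    moreover from this have "0 \<le> (Pmax pl k + alpha pl k) * real (Dmax pl k)"
      using mean_demand_bounds(1)[OF p y, of k]
      by (meson abs_ge_zero mult_nonneg_nonneg order_trans)
    ultimately show "\<bar>of_bool (z k) * (p k - alpha pl k) * mean_demand pl k (p k) y\<bar>
        \<le> (Pmax pl k + alpha pl k) * real (Dmax pl k)"
      using mean_demand_bounds[OF p y, of k]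
      by (cases "z k") (auto simp: abs_mult mult_nonneg_nonneg)
  qed
  then show ?thesis using purchase_bounds(2,3)[OF x a] by auto
qed

end
section \<open>Inventory bounds under the joint purchasing and pricing algorithm\<close>

locale jpp_run = prob_space \<Omega>
  for \<Omega> :: "'w measure" +
  fixes pl :: "('m::finite, 'k::finite, 'y) plant"
    and r :: "('w, 'm, 'k, 'y) run"
    and V :: real
  assumes valid: "valid_plant pl"
    and run: "plant_run \<Omega> pl r"
    and V_pos: "V > 0"
    and jpp: "follows_jpp \<Omega> pl V (theta pl V) r"
    and initial_inventory: "\<omega> \<in> space \<Omega> \<Longrightarrow> mu_max pl m \<le> of_int (inventory r 0 \<omega> m)"
      "\<omega> \<in> space \<Omega> \<Longrightarrow> of_int (inventory r 0 \<omega> m) \<le> theta pl V m + Amax pl m"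
begin

definition excess :: "nat \<Rightarrow> 'w \<Rightarrow> 'm \<Rightarrow> real" where
  "excess t \<omega> m = of_int (inventory r t \<omega> m) - theta pl V m"

definition consumed :: "nat \<Rightarrow> 'w \<Rightarrow> 'm \<Rightarrow> real" where
  "consumed t \<omega> m =
     (\<Sum>k\<in>UNIV. real (beta pl m k) * of_bool (offered r t \<omega> k) * real (demand r t \<omega> k))"

lemma states:
  assumes "\<omega> \<in> space \<Omega>"
  shows "sstate r t \<omega> \<in> supply_states pl" "dstate r t \<omega> \<in> demand_states pl"
proof -
  have "sstate r t \<in> \<Omega> \<rightarrow>\<^sub>M count_space (supply_states pl)"
    "dstate r t \<in> \<Omega> \<rightarrow>\<^sub>M count_space (demand_states pl)"
    using run by (auto simp: plant_run_def)
  from this[THEN measurable_space, OF assms]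
  show "sstate r t \<omega> \<in> supply_states pl" "dstate r t \<omega> \<in> demand_states pl" by auto
qed

lemma decisions_admissible:
  assumes "\<omega> \<in> space \<Omega>"
  shows "purchase r t \<omega> \<in> purchases pl (sstate r t \<omega>)" "price r t \<omega> k \<in> price_set pl k"
    "demand r t \<omega> k \<le> Dmax pl k"
  using run assms unfolding plant_run_def by blast+

lemma purchase_minimizes:
  assumes "\<omega> \<in> space \<Omega>" "a \<in> purchases pl (sstate r t \<omega>)"
  shows "jpp_purchase_obj V (theta pl V) (inventory r t \<omega>) (sstate r t \<omega>) (purchase r t \<omega>)
    \<le> jpp_purchase_obj V (theta pl V) (inventory r t \<omega>) (sstate r t \<omega>) a"
proof -
  obtain ra where
    "\<forall>q. \<forall>x\<in>supply_states pl. \<forall>y\<in>demand_states pl.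
       is_arg_min (jpp_purchase_obj V (theta pl V) q x) (\<lambda>a. a \<in> purchases pl x) (ra q x y)"
    "\<forall>t. \<forall>\<omega>\<in>space \<Omega>. purchase r t \<omega> = ra (inventory r t \<omega>) (sstate r t \<omega>) (dstate r t \<omega>)"
    using jpp unfolding follows_jpp_def by blast
  with assms states[of \<omega> t] show ?thesis unfolding is_arg_min_def by (metis not_le)
qed

lemma price_maximizes:
  assumes "\<omega> \<in> space \<Omega>" "p \<in> price_set pl k" "\<not> jpp_blocked pl (inventory r t \<omega>) k"
  shows "jpp_price_obj pl V (theta pl V) (inventory r t \<omega>) (dstate r t \<omega>) k p
    \<le> jpp_price_obj pl V (theta pl V) (inventory r t \<omega>) (dstate r t \<omega>) k (price r t \<omega> k)"
proof -
  obtain rp where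
    "\<forall>q. \<forall>x\<in>supply_states pl. \<forall>y\<in>demand_states pl. \<forall>k. \<not> jpp_blocked pl q k \<longrightarrow>
       is_arg_max (jpp_price_obj pl V (theta pl V) q y k) (\<lambda>p. p \<in> price_set pl k) (rp q x y k)"
    "\<forall>t. \<forall>\<omega>\<in>space \<Omega>. price r t \<omega> = rp (inventory r t \<omega>) (sstate r t \<omega>) (dstate r t \<omega>)"
    using jpp unfolding follows_jpp_def by blast
  with assms states[of \<omega> t] show ?thesis unfolding is_arg_max_def by (metis not_le)
qed

lemma offered_iff:
  assumes "\<omega> \<in> space \<Omega>"
  shows "offered r t \<omega> k \<longleftrightarrow> \<not> jpp_blocked pl (inventory r t \<omega>) k \<and>
    jpp_price_obj pl V (theta pl V) (inventory r t \<omega>) (dstate r t \<omega>) k (price r t \<omega> k) > 0"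
  and sold_eq: "sold r t \<omega> k = of_bool (offered r t \<omega> k) * demand r t \<omega> k"
  using jpp assms unfolding follows_jpp_def by blast+

lemma consumed_bounds:
  assumes "\<omega> \<in> space \<Omega>"
  shows "0 \<le> consumed t \<omega> m" "consumed t \<omega> m \<le> mu_max pl m"
proof -
  show "0 \<le> consumed t \<omega> m" by (simp add: consumed_def sum_nonneg)
  show "consumed t \<omega> m \<le> mu_max pl m"
    unfolding consumed_def mu_max_def using decisions_admissible(3)[OF assms]
    by (intro sum_mono) (auto intro!: mult_left_mono)
qed

text \<open>Above the threshold every unit of \<open>m\<close> enters the purchasing objective with a positive
  weight. Leaving \<open>m\<close> out of the purchase is feasible and would be strictly better.\<close>

lemma no_purchase_above_threshold:
  assumes \<omega>: "\<omega> \<in> space \<Omega>" and above: "excess t \<omega> m > 0"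
  shows "purchase r t \<omega> m = 0"
proof (rule ccontr)
  define a where "a = purchase r t \<omega>"
  define x where "x = sstate r t \<omega>"
  define a' where "a' = a(m := 0)"
  assume "purchase r t \<omega> m \<noteq> 0"
  then have pos: "real (a m) > 0" by (simp add: a_def)
  have x: "x \<in> supply_states pl" and a: "a \<in> purchases pl x"
    using states[OF \<omega>] decisions_admissible[OF \<omega>] by (auto simp: a_def x_def)
  have x_nonneg: "fst x i \<ge> 0" "snd x i \<ge> 0" for i
    using valid x by (auto simp: valid_plant_def)
  have split: "(\<Sum>i\<in>UNIV. g i * real (a i)) = (\<Sum>i\<in>UNIV. g i * real (a' i)) + g m * real (a m)"
    for g :: "'m \<Rightarrow> real"
    by (simp add: a'_def sum.remove[of UNIV m])
  have cost: "purchase_cost a x = purchase_cost a' x + fst x m * real (a m)"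
    unfolding purchase_cost_def by (rule split)
  have "real (a' i) \<le> min (Amax pl i) (snd x i)" for i
    using a x_nonneg[of i] Amax_nonneg[OF valid, of i] by (auto simp: a'_def purchases_def)
  moreover have "purchase_cost a' x \<le> cmax pl"
    using cost purchase_bounds(3)[OF valid x a] x_nonneg(1)[of m] pos
    by (smt (verit) mult_nonneg_nonneg)
  ultimately have "a' \<in> purchases pl x" by (auto simp: purchases_def)
  from purchase_minimizes[OF \<omega> this[unfolded x_def]]
  have "V * purchase_cost a x + (\<Sum>i\<in>UNIV. excess t \<omega> i * real (a i))
      \<le> V * purchase_cost a' x + (\<Sum>i\<in>UNIV. excess t \<omega> i * real (a' i))"
    by (simp add: jpp_purchase_obj_def a_def x_def excess_def mult.commute)
  then have "V * (fst x m * real (a m)) + excess t \<omega> m * real (a m) \<le> 0"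
    unfolding cost split by (simp add: algebra_simps)
  moreover have "V * (fst x m * real (a m)) \<ge> 0" using V_pos x_nonneg(1)[of m] by simp
  moreover have "excess t \<omega> m * real (a m) > 0" using above pos by simp
  ultimately show False by linarith
qed

lemma threshold_ge:
  assumes "beta pl m k > 0"
  shows "theta pl V m \<ge> V * (Pmax pl k - alpha pl k) / real (beta pl m k)
     + (\<Sum>i\<in>UNIV - {m}. real (beta pl i k) * Amax pl i / real (beta pl m k)) + 2 * mu_max pl m"
  unfolding theta_def using assms by (intro Max_ge) auto

text \<open>This is what the threshold is designed for. With less than \<open>2 * mu_max pl m\<close> units of \<open>m\<close>
  in stock, the negative weight of material \<open>m\<close> outweighs the largest possible revenue and the
  largest possible positive weights of the other materials.\<close>

lemma not_offered_when_scarce: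
  assumes \<omega>: "\<omega> \<in> space \<Omega>" and scarce: "of_int (inventory r t \<omega> m) < 2 * mu_max pl m"
    and upper: "\<And>i. excess t \<omega> i \<le> Amax pl i" and uses: "beta pl m k > 0"
  shows "\<not> offered r t \<omega> k"
proof -
  define p where "p = price r t \<omega> k"
  define y where "y = dstate r t \<omega>"
  define others where "others = (\<Sum>i\<in>UNIV - {m}. real (beta pl i k) * Amax pl i)"
  let ?b = "real (beta pl m k)"
  have p: "p \<in> price_set pl k" and y: "y \<in> demand_states pl"
    using decisions_admissible[OF \<omega>] states[OF \<omega>] by (auto simp: p_def y_def)
  have b: "?b > 0" using uses by simp
  have "theta pl V m \<ge> (V * (Pmax pl k - alpha pl k) + others) / ?b + 2 * mu_max pl m"
    using threshold_ge[OF uses] by (simp add: others_def sum_divide_distrib add_divide_distrib)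
  then have "(V * (Pmax pl k - alpha pl k) + others) / ?b \<le> - excess t \<omega> m"
    using scarce by (simp add: excess_def)
  then have "V * (Pmax pl k - alpha pl k) + others + ?b * excess t \<omega> m \<le> 0"
    using b by (simp add: field_simps)
  moreover have "V * (p - alpha pl k) \<le> V * (Pmax pl k - alpha pl k)"
    using V_pos price_bounds(2)[OF valid p] by simp
  moreover have "(\<Sum>i\<in>UNIV. real (beta pl i k) * excess t \<omega> i)
      \<le> ?b * excess t \<omega> m + others"
    unfolding others_def by (subst sum.remove[of UNIV m]) (auto intro!: sum_mono mult_left_mono upper)
  ultimately have "V * (p - alpha pl k) + (\<Sum>i\<in>UNIV. real (beta pl i k) * excess t \<omega> i) \<le> 0"
    by linarith
  then have "mean_demand pl k p y
      * (V * (p - alpha pl k) + (\<Sum>i\<in>UNIV. real (beta pl i k) * excess t \<omega> i)) \<le> 0"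
    using mean_demand_bounds(1)[OF valid p y] by (simp add: mult_nonneg_nonpos)
  then have "jpp_price_obj pl V (theta pl V) (inventory r t \<omega>) y k p \<le> 0"
    by (simp add: jpp_price_obj_def excess_def algebra_simps)
  then show ?thesis using offered_iff[OF \<omega>, of t k] by (simp add: p_def y_def)
qed

lemma inventory_Suc:
  assumes "\<omega> \<in> space \<Omega>" "mu_max pl m \<le> of_int (inventory r t \<omega> m)"
  shows "real_of_int (inventory r (Suc t) \<omega> m) =
    of_int (inventory r t \<omega> m) - consumed t \<omega> m + real (purchase r t \<omega> m)"
proof -
  have "inventory r t \<omega> m \<ge> 0" using assms(2) mu_max_nonneg[of pl m] by linarith
  from jpp_queue_update[OF run jpp assms(1) this] show ?thesis by (simp add: consumed_def)
qed

lemma inventory_bounds: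
  assumes \<omega>: "\<omega> \<in> space \<Omega>"
  shows "mu_max pl m \<le> of_int (inventory r t \<omega> m)
    \<and> of_int (inventory r t \<omega> m) \<le> theta pl V m + Amax pl m"
proof (induction t arbitrary: m)
  case 0
  show ?case using initial_inventory[OF \<omega>] by simp
next
  case (Suc t)
  have upper: "excess t \<omega> i \<le> Amax pl i" for i
    using Suc[of i] by (simp add: excess_def)
  note step = inventory_Suc[OF \<omega>, of m t] and cons = consumed_bounds[OF \<omega>, of t m]
  have A: "real (purchase r t \<omega> m) \<le> Amax pl m"
    using purchase_bounds(1)[OF valid states(1)[OF \<omega>] decisions_admissible(1)[OF \<omega>]] .
  have "mu_max pl m \<le> of_int (inventory r (Suc t) \<omega> m)"
  proof (cases "of_int (inventory r t \<omega> m) < 2 * mu_max pl m")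
    case True
    have "consumed t \<omega> m = 0"
      unfolding consumed_def using not_offered_when_scarce[OF \<omega> True upper]
      by (intro sum.neutral) auto
    with step Suc[of m] show ?thesis by simp
  next
    case False
    with step cons Suc[of m] show ?thesis by simp
  qed
  moreover have "of_int (inventory r (Suc t) \<omega> m) \<le> theta pl V m + Amax pl m"
  proof (cases "excess t \<omega> m > 0")
    case True
    with no_purchase_above_threshold[OF \<omega> True] step cons Suc[of m] show ?thesis by simp
  next
    case False
    with step cons Suc[of m] A show ?thesis by (simp add: excess_def)
  qed
  ultimately show ?case by simp
qed

text \<open>Because of the lower bound, the rule that blocks scarce products is never invoked. This makes
  the pricing step an unrestricted maximization.\<close>

lemma not_blocked:
  assumes "\<omega> \<in> space \<Omega>"
  shows "\<not> jpp_blocked pl (inventory r t \<omega>) k"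
  using inventory_bounds[OF assms] by (auto simp: jpp_blocked_def not_less)

lemma excess_Suc:
  assumes "\<omega> \<in> space \<Omega>"
  shows "excess (Suc t) \<omega> m = excess t \<omega> m + (real (purchase r t \<omega> m) - consumed t \<omega> m)"
  using inventory_Suc[OF assms] inventory_bounds[OF assms, of m t] by (simp add: excess_def)

lemma excess_bound:
  assumes "\<omega> \<in> space \<Omega>"
  shows "\<bar>excess t \<omega> m\<bar> \<le> max (theta pl V m) (Amax pl m)"
  using inventory_bounds[OF assms, of m t] mu_max_nonneg[of pl m] by (auto simp: excess_def)

definition maxstep :: "'m \<Rightarrow> real" where
  "maxstep m = max (Amax pl m) (mu_max pl m)"

lemma maxstep_nonneg: "maxstep m \<ge> 0"
  using mu_max_nonneg[of pl m] by (simp add: maxstep_def)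

lemma drift_const_eq: "drift_const pl = (1 / 2) * (\<Sum>m\<in>UNIV. (maxstep m)\<^sup>2)"
proof -
  have "max ((Amax pl m)\<^sup>2) ((mu_max pl m)\<^sup>2) = (maxstep m)\<^sup>2" for m
    unfolding maxstep_def
    using power_mono[of "Amax pl m" "mu_max pl m" 2] power_mono[of "mu_max pl m" "Amax pl m" 2]
      Amax_nonneg[OF valid, of m] mu_max_nonneg[of pl m]
    by (auto simp: max_def)
  then show ?thesis by (simp add: drift_const_def)
qed

lemma step_bound:
  assumes "\<omega> \<in> space \<Omega>"
  shows "\<bar>real (purchase r t \<omega> m) - consumed t \<omega> m\<bar> \<le> maxstep m"
  using purchase_bounds(1)[OF valid states(1)[OF assms] decisions_admissible(1)[OF assms], of t m]
    consumed_bounds[OF assms, of t m] by (auto simp: maxstep_def)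

lemma excess_diff_bound:
  assumes "\<omega> \<in> space \<Omega>"
  shows "\<bar>excess (t + s) \<omega> m - excess t \<omega> m\<bar> \<le> real s * maxstep m"
proof (induction s)
  case (Suc s)
  then show ?case
    using step_bound[OF assms, of "t + s" m] excess_Suc[OF assms, of "t + s" m]
    by (simp add: distrib_right)
qed simp

section \<open>Measurability and conditional expectations\<close>

lemma integrable_bounded:
  assumes "f \<in> borel_measurable \<Omega>" "\<And>\<omega>. \<omega> \<in> space \<Omega> \<Longrightarrow> \<bar>f \<omega>\<bar> \<le> (C::real)"
  shows "integrable \<Omega> f"
  by (rule integrable_const_bound[where B = C]) (use assms in auto)

lemma integral_le_bound:
  assumes "integrable \<Omega> f" "AE \<omega> in \<Omega>. f \<omega> \<le> (C::real)"
  shows "(\<integral>\<omega>. f \<omega> \<partial>\<Omega>) \<le> C"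
  using integral_mono_AE[OF assms(1) _ assms(2)] by (simp add: prob_space)

lemma countable_states: "countable (supply_states pl)" "countable (demand_states pl)"
  using valid by (auto simp: valid_plant_def)

lemma run_measurable [measurable]:
  "sstate r t \<in> \<Omega> \<rightarrow>\<^sub>M count_space (supply_states pl)"
  "dstate r t \<in> \<Omega> \<rightarrow>\<^sub>M count_space (demand_states pl)"
  "inventory r t \<in> \<Omega> \<rightarrow>\<^sub>M count_space UNIV"
  "purchase r t \<in> \<Omega> \<rightarrow>\<^sub>M count_space UNIV"
  "offered r t \<in> \<Omega> \<rightarrow>\<^sub>M count_space UNIV"
  "(\<lambda>\<omega>. price r t \<omega> k) \<in> borel_measurable \<Omega>"
  "demand r t \<in> \<Omega> \<rightarrow>\<^sub>M count_space UNIV"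
  "sold r t \<in> \<Omega> \<rightarrow>\<^sub>M count_space UNIV"
  using run by (auto simp: plant_run_def)

text \<open>A state outside the state space has empty preimage, so its level set is an event, too.\<close>

lemma level_sets:
  "sstate r t -` {x} \<inter> space \<Omega> \<in> sets \<Omega>" "dstate r t -` {y} \<inter> space \<Omega> \<in> sets \<Omega>"
proof -
  have "sstate r t -` ({x} \<inter> supply_states pl) \<inter> space \<Omega> \<in> sets \<Omega>"
    "dstate r t -` ({y} \<inter> demand_states pl) \<inter> space \<Omega> \<in> sets \<Omega>"
    by (rule measurable_sets[OF run_measurable(1)] measurable_sets[OF run_measurable(2)], simp)+
  moreover have "sstate r t -` {x} \<inter> space \<Omega> = sstate r t -` ({x} \<inter> supply_states pl) \<inter> space \<Omega>"
    "dstate r t -` {y} \<inter> space \<Omega> = dstate r t -` ({y} \<inter> demand_states pl) \<inter> space \<Omega>"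
    using states by auto
  ultimately show "sstate r t -` {x} \<inter> space \<Omega> \<in> sets \<Omega>" "dstate r t -` {y} \<inter> space \<Omega> \<in> sets \<Omega>"
    by simp_all
qed

lemma space_past: "space (past \<Omega> r t) = space \<Omega>"
  by (simp add: past_def space_measure_of_conv)

lemma space_history: "space (history \<Omega> r t) = space \<Omega>"
  by (simp add: history_def space_measure_of_conv)

lemma subalgebra_past: "subalgebra \<Omega> (past \<Omega> r t)"
proof -
  have "sets (past \<Omega> r t) \<subseteq> sets \<Omega>"
    unfolding past_def
    by (subst sets_measure_of, force, rule sets.sigma_sets_subset)
      (auto intro: level_sets run_measurable(6)[THEN measurable_sets]
        run_measurable(3,4,5,7,8)[THEN measurable_sets])
  then show ?thesis by (simp add: subalgebra_def space_past space_history)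
qed

lemma subalgebra_history: "subalgebra \<Omega> (history \<Omega> r t)"
proof -
  have "sets (history \<Omega> r t) \<subseteq> sets \<Omega>"
    unfolding history_def
    by (subst sets_measure_of, force, rule sets.sigma_sets_subset)
      (auto intro: level_sets run_measurable(3)[THEN measurable_sets])
  then show ?thesis by (simp add: subalgebra_def space_past space_history)
qed

lemma finite_measure_subalgebraI: "subalgebra \<Omega> F \<Longrightarrow> finite_measure_subalgebra \<Omega> F"
  by unfold_locales

lemma inventory_measurable_history:
  "inventory r t \<in> history \<Omega> r t \<rightarrow>\<^sub>M count_space UNIV"
proof (subst measurable_count_space_eq2_countable, intro conjI ballI countableI_type)
  fix q :: "'m \<Rightarrow> int"
  show "inventory r t -` {q} \<inter> space (history \<Omega> r t) \<in> sets (history \<Omega> r t)"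
    unfolding space_history
    unfolding history_def by (subst sets_measure_of, force, rule sigma_sets.Basic, blast)
qed simp

lemma past_generators:
  shows "sstate r t -` {x} \<inter> space \<Omega> \<in> sets (past \<Omega> r t)" (is "?X \<in> _")
   "dstate r t -` {y} \<inter> space \<Omega> \<in> sets (past \<Omega> r t)" (is "?Y \<in> _")
   "inventory r t -` {q} \<inter> space \<Omega> \<in> sets (past \<Omega> r t)" (is "?Q \<in> _")
proof -
  have "?X \<in> {sstate r \<tau> -` {x} \<inter> space \<Omega> | \<tau> x. True}" by blast
  then show "?X \<in> sets (past \<Omega> r t)"
    unfolding past_def by (intro in_measure_of, force) (simp only: Un_iff simp_thms)
  have "?Y \<in> {dstate r \<tau> -` {y} \<inter> space \<Omega> | \<tau> y. True}" by blast
  then show "?Y \<in> sets (past \<Omega> r t)"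
    unfolding past_def by (intro in_measure_of, force) (simp only: Un_iff simp_thms)
  have "?Q \<in> {inventory r \<tau> -` {q} \<inter> space \<Omega> | \<tau> q. \<tau> \<le> t}" by blast
  then show "?Q \<in> sets (past \<Omega> r t)"
    unfolding past_def by (intro in_measure_of, force) (simp only: Un_iff simp_thms)
qed

lemma state_measurable_past:
  "(\<lambda>\<omega>. (inventory r t \<omega>, sstate r t \<omega>, dstate r t \<omega>))
    \<in> past \<Omega> r t \<rightarrow>\<^sub>M count_space (UNIV \<times> supply_states pl \<times> demand_states pl)"
proof -
  have countable: "countable ((UNIV :: ('m \<Rightarrow> int) set) \<times> supply_states pl \<times> demand_states pl)"
    by (intro countable_SIGMA countable_states countableI_type)
  have range: "(\<lambda>\<omega>. (inventory r t \<omega>, sstate r t \<omega>, dstate r t \<omega>))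
      \<in> space (past \<Omega> r t) \<rightarrow> UNIV \<times> supply_states pl \<times> demand_states pl"
    using states by (auto simp: space_past)
  have levels: "(\<lambda>\<omega>. (inventory r t \<omega>, sstate r t \<omega>, dstate r t \<omega>)) -` {s}
      \<inter> space (past \<Omega> r t) \<in> sets (past \<Omega> r t)" for s
  proof -
    obtain q x y where s: "s = (q, x, y)" by (cases s)
    have "inventory r t -` {q} \<inter> space \<Omega> \<in> sets (past \<Omega> r t)"
      "sstate r t -` {x} \<inter> space \<Omega> \<in> sets (past \<Omega> r t)"
      "dstate r t -` {y} \<inter> space \<Omega> \<in> sets (past \<Omega> r t)"
      by (rule past_generators)+
    then have "(inventory r t -` {q} \<inter> space \<Omega>) \<inter> (sstate r t -` {x} \<inter> space \<Omega>)
        \<inter> (dstate r t -` {y} \<inter> space \<Omega>) \<in> sets (past \<Omega> r t)"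
      by (rule sets.Int[OF sets.Int])
    moreover have "(\<lambda>\<omega>. (inventory r t \<omega>, sstate r t \<omega>, dstate r t \<omega>)) -` {s} \<inter> space (past \<Omega> r t)
      = (inventory r t -` {q} \<inter> space \<Omega>) \<inter> (sstate r t -` {x} \<inter> space \<Omega>)
        \<inter> (dstate r t -` {y} \<inter> space \<Omega>)"
      by (auto simp: s space_past)
    ultimately show ?thesis by simp
  qed
  show ?thesis
    by (rule measurable_count_space_eq_countable[OF countable, THEN iffD2])
      (intro conjI ballI range levels)
qed

text \<open>Since the algorithm selects its decisions by a fixed rule, they depend on countably many
  values only. Hence \<open>h\<close> may be any function. In particular it may involve the demand law, whose
  dependence on the price need not be measurable.\<close>

lemma decision_measurable_past:
  fixes h :: "('m \<Rightarrow> int) \<Rightarrow> 'm supply_state \<Rightarrow> 'y \<Rightarrow> ('m \<Rightarrow> nat) \<Rightarrow> ('k \<Rightarrow> real) \<Rightarrow>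
    ('k \<Rightarrow> bool) \<Rightarrow> real"
  shows "(\<lambda>\<omega>. h (inventory r t \<omega>) (sstate r t \<omega>) (dstate r t \<omega>) (purchase r t \<omega>)
    (price r t \<omega>) (offered r t \<omega>)) \<in> borel_measurable (past \<Omega> r t)"
proof -
  obtain ra rp where
    ra: "\<forall>\<omega>\<in>space \<Omega>. purchase r t \<omega> = ra (inventory r t \<omega>) (sstate r t \<omega>) (dstate r t \<omega>)" and
    rp: "\<forall>\<omega>\<in>space \<Omega>. price r t \<omega> = rp (inventory r t \<omega>) (sstate r t \<omega>) (dstate r t \<omega>)"
    using jpp unfolding follows_jpp_def by blast
  define z where "z q x y = (\<lambda>k. \<not> jpp_blocked pl q k \<and>
    jpp_price_obj pl V (theta pl V) q y k (rp q x y k) > 0)" for q x y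
  have z: "offered r t \<omega> = z (inventory r t \<omega>) (sstate r t \<omega>) (dstate r t \<omega>)"
    if "\<omega> \<in> space \<Omega>" for \<omega>
    unfolding z_def using offered_iff[OF that, of t] rp that by (intro ext) simp
  have "(\<lambda>\<omega>. (\<lambda>(q, x, y). h q x y (ra q x y) (rp q x y) (z q x y))
      (inventory r t \<omega>, sstate r t \<omega>, dstate r t \<omega>)) \<in> borel_measurable (past \<Omega> r t)"
    by (rule measurable_compose[OF state_measurable_past]) simp
  also have "?this \<longleftrightarrow> ?thesis"
    by (rule measurable_cong) (simp add: space_past ra rp z)
  finally show ?thesis .
qed

lemmas decision_measurable = measurable_from_subalg[OF subalgebra_past decision_measurable_past]

text \<open>What is decided in a slot is known before its demand is drawn, so in expectations the demand
  may be replaced by its conditional mean.\<close>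

lemma expectation_demand:
  assumes g: "g \<in> borel_measurable (past \<Omega> r t)"
    and bound: "\<And>\<omega>. \<omega> \<in> space \<Omega> \<Longrightarrow> \<bar>g \<omega>\<bar> \<le> C"
  shows "(\<integral>\<omega>. g \<omega> * real (demand r t \<omega> k) \<partial>\<Omega>)
    = (\<integral>\<omega>. g \<omega> * mean_demand pl k (price r t \<omega> k) (dstate r t \<omega>) \<partial>\<Omega>)"
proof -
  interpret S: finite_measure_subalgebra \<Omega> "past \<Omega> r t"
    by (rule finite_measure_subalgebraI[OF subalgebra_past])
  let ?I = "\<lambda>d \<omega>. of_bool (demand r t \<omega> k = d) :: real"
  let ?p = "\<lambda>d \<omega>. pmf (demand_law pl k (price r t \<omega> k) (dstate r t \<omega>)) d"
  have gM [measurable]: "g \<in> borel_measurable \<Omega>"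
    by (rule measurable_from_subalg[OF subalgebra_past g])
  have [measurable]: "(\<lambda>\<omega>. demand r t \<omega> k) \<in> \<Omega> \<rightarrow>\<^sub>M count_space UNIV"
    by (rule measurable_compose[OF run_measurable(7)]) simp
  have pM [measurable]: "?p d \<in> borel_measurable \<Omega>" for d
    by (rule decision_measurable[where h = "\<lambda>_ _ y _ p _. pmf (demand_law pl k (p k) y) d"])
  have I: "integrable \<Omega> (\<lambda>\<omega>. g \<omega> * ?I d \<omega>)" for d
    by (rule integrable_bounded[where C = C]) (use bound in \<open>auto intro: order_trans[OF abs_ge_zero]\<close>)
  have p: "integrable \<Omega> (\<lambda>\<omega>. g \<omega> * ?p d \<omega>)" for d
  proof (rule integrable_bounded[where C = C])
    fix \<omega> assume "\<omega> \<in> space \<Omega>"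
    then have "\<bar>g \<omega>\<bar> * ?p d \<omega> \<le> C * 1"
      using bound[of \<omega>] by (intro mult_mono) (auto simp: pmf_le_1 intro: order_trans[OF abs_ge_zero])
    then show "\<bar>g \<omega> * ?p d \<omega>\<bar> \<le> C" by (simp add: abs_mult)
  qed simp
  have one: "(\<integral>\<omega>. g \<omega> * ?I d \<omega> \<partial>\<Omega>) = (\<integral>\<omega>. g \<omega> * ?p d \<omega> \<partial>\<Omega>)" for d
  proof -
    have "(\<integral>\<omega>. g \<omega> * ?I d \<omega> \<partial>\<Omega>) = (\<integral>\<omega>. g \<omega> * real_cond_exp \<Omega> (past \<Omega> r t) (?I d) \<omega> \<partial>\<Omega>)"
      by (rule S.real_cond_exp_intg(2)[OF I g, symmetric]) simp
    also have "\<dots> = (\<integral>\<omega>. g \<omega> * ?p d \<omega> \<partial>\<Omega>)"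
    proof (rule integral_cong_AE)
      have "AE \<omega> in \<Omega>. real_cond_exp \<Omega> (past \<Omega> r t) (?I d) \<omega> = ?p d \<omega>"
        using run unfolding plant_run_def by blast
      then show "AE \<omega> in \<Omega>. g \<omega> * real_cond_exp \<Omega> (past \<Omega> r t) (?I d) \<omega> = g \<omega> * ?p d \<omega>"
        by eventually_elim simp
    qed (use pM gM in measurable)
    finally show ?thesis .
  qed
  have "(\<integral>\<omega>. g \<omega> * real (demand r t \<omega> k) \<partial>\<Omega>)
      = (\<integral>\<omega>. (\<Sum>d\<le>Dmax pl k. real d * (g \<omega> * ?I d \<omega>)) \<partial>\<Omega>)"
  proof (rule Bochner_Integration.integral_cong)
    fix \<omega> assume "\<omega> \<in> space \<Omega>"
    then have "(\<Sum>d\<le>Dmax pl k. real d * (g \<omega> * ?I d \<omega>))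
        = (\<Sum>d\<in>{demand r t \<omega> k}. real d * (g \<omega> * ?I d \<omega>))"
      using decisions_admissible(3) by (intro sum.mono_neutral_right) auto
    then show "g \<omega> * real (demand r t \<omega> k) = (\<Sum>d\<le>Dmax pl k. real d * (g \<omega> * ?I d \<omega>))"
      by simp
  qed simp
  also have "\<dots> = (\<Sum>d\<le>Dmax pl k. real d * (\<integral>\<omega>. g \<omega> * ?I d \<omega> \<partial>\<Omega>))"
    by (subst Bochner_Integration.integral_sum) (auto intro!: I)
  also have "\<dots> = (\<Sum>d\<le>Dmax pl k. real d * (\<integral>\<omega>. g \<omega> * ?p d \<omega> \<partial>\<Omega>))"
    by (simp add: one)
  also have "\<dots> = (\<integral>\<omega>. (\<Sum>d\<le>Dmax pl k. real d * (g \<omega> * ?p d \<omega>)) \<partial>\<Omega>)"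
    by (subst Bochner_Integration.integral_sum) (auto intro!: p)
  also have "\<dots> = (\<integral>\<omega>. g \<omega> * mean_demand pl k (price r t \<omega> k) (dstate r t \<omega>) \<partial>\<Omega>)"
    by (rule Bochner_Integration.integral_cong)
      (auto simp: mean_demand_eq_sum[OF valid decisions_admissible(2) states(2)] sum_distrib_left
        mult_ac)
  finally show ?thesis .
qed


section \<open>Drift of a quadratic Lyapunov function\<close>

definition lyapunov :: "nat \<Rightarrow> 'w \<Rightarrow> real" where
  "lyapunov t \<omega> = (1 / 2) * (\<Sum>m\<in>UNIV. (excess t \<omega> m)\<^sup>2)"

definition purchase_weight :: "nat \<Rightarrow> 'w \<Rightarrow> real" where
  "purchase_weight t \<omega> = V * purchase_cost (purchase r t \<omega>) (sstate r t \<omega>)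
     + (\<Sum>m\<in>UNIV. excess t \<omega> m * real (purchase r t \<omega> m))"

definition sale_weight :: "nat \<Rightarrow> 'k \<Rightarrow> 'w \<Rightarrow> real" where
  "sale_weight t k \<omega> = of_bool (offered r t \<omega> k) *
     (V * (price r t \<omega> k - alpha pl k) + (\<Sum>m\<in>UNIV. real (beta pl m k) * excess t \<omega> m))"

lemma lyapunov_nonneg: "lyapunov t \<omega> \<ge> 0"
  by (simp add: lyapunov_def sum_nonneg)

lemma lyapunov_Suc:
  assumes \<omega>: "\<omega> \<in> space \<Omega>"
  shows "lyapunov (Suc t) \<omega> \<le> lyapunov t \<omega> + drift_const pl
    + (\<Sum>m\<in>UNIV. excess t \<omega> m * (real (purchase r t \<omega> m) - consumed t \<omega> m))"
proof -
  have "(excess (Suc t) \<omega> m)\<^sup>2 \<le> (excess t \<omega> m)\<^sup>2 + (maxstep m)\<^sup>2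
      + 2 * (excess t \<omega> m * (real (purchase r t \<omega> m) - consumed t \<omega> m))" for m
  proof -
    have "(real (purchase r t \<omega> m) - consumed t \<omega> m)\<^sup>2 \<le> (maxstep m)\<^sup>2"
      using step_bound[OF \<omega>, of t m] by (rule abs_le_square_iff[THEN iffD1, OF order_trans]) simp
    then show ?thesis unfolding excess_Suc[OF \<omega>] by (simp add: power2_sum)
  qed
  then have "(\<Sum>m\<in>UNIV. (excess (Suc t) \<omega> m)\<^sup>2) \<le> (\<Sum>m\<in>UNIV. (excess t \<omega> m)\<^sup>2 + (maxstep m)\<^sup>2
      + 2 * (excess t \<omega> m * (real (purchase r t \<omega> m) - consumed t \<omega> m)))"
    by (rule sum_mono)
  then show ?thesis
    unfolding lyapunov_def drift_const_eq by (simp add: sum.distrib sum_distrib_left[symmetric])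
qed

text \<open>The profit of the slot is subtracted from the drift in order to collect all terms that
  depend on the demand of a product.\<close>

lemma drift_minus_profit:
  assumes \<omega>: "\<omega> \<in> space \<Omega>"
  shows "lyapunov (Suc t) \<omega> - V * phi_actual pl r t \<omega>
    \<le> lyapunov t \<omega> + drift_const pl + purchase_weight t \<omega>
      - (\<Sum>k\<in>UNIV. sale_weight t k \<omega> * real (demand r t \<omega> k))"
proof -
  have "(\<Sum>m\<in>UNIV. excess t \<omega> m * consumed t \<omega> m)
      = (\<Sum>k\<in>UNIV. \<Sum>m\<in>UNIV. excess t \<omega> m *
          (real (beta pl m k) * of_bool (offered r t \<omega> k) * real (demand r t \<omega> k)))"
    unfolding consumed_def sum_distrib_left by (rule sum.swap)
  moreover have "(\<Sum>k\<in>UNIV. sale_weight t k \<omega> * real (demand r t \<omega> k))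
      = V * (\<Sum>k\<in>UNIV. of_bool (offered r t \<omega> k) * real (sold r t \<omega> k) * (price r t \<omega> k - alpha pl k))
        + (\<Sum>k\<in>UNIV. \<Sum>m\<in>UNIV. excess t \<omega> m *
          (real (beta pl m k) * of_bool (offered r t \<omega> k) * real (demand r t \<omega> k)))"
    unfolding sum_distrib_left sum.distrib[symmetric]
    by (intro sum.cong refl)
      (simp add: sale_weight_def sold_eq[OF \<omega>] sum_distrib_left sum_distrib_right algebra_simps)
  ultimately show ?thesis
    using lyapunov_Suc[OF \<omega>, of t]
    by (simp add: purchase_weight_def phi_actual_def right_diff_distrib sum_subtractf algebra_simps)
qed

text \<open>The algorithm minimizes the part of the drift bound that it can influence. As no product is
  ever blocked, it competes with all admissible decisions, and it does so on every sample path
  separately.\<close>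

lemma jpp_minimizes_drift_bound:
  assumes \<omega>: "\<omega> \<in> space \<Omega>" and a: "a \<in> purchases pl (sstate r t \<omega>)"
    and p: "\<And>k. p k \<in> price_set pl k"
  shows "purchase_weight t \<omega>
      - (\<Sum>k\<in>UNIV. sale_weight t k \<omega> * mean_demand pl k (price r t \<omega> k) (dstate r t \<omega>))
    \<le> (\<Sum>m\<in>UNIV. excess t \<omega> m * mean_surplus pl (dstate r t \<omega>) m (a, z, p))
      - V * mean_profit pl (sstate r t \<omega>) (dstate r t \<omega>) (a, z, p)"
proof -
  define y where "y = dstate r t \<omega>"
  define obj where "obj k p = jpp_price_obj pl V (theta pl V) (inventory r t \<omega>) y k p" for k p
  have obj: "obj k p = mean_demand pl k p y
      * (V * (p - alpha pl k) + (\<Sum>m\<in>UNIV. real (beta pl m k) * excess t \<omega> m))" for k p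
    by (simp add: obj_def jpp_price_obj_def excess_def algebra_simps)
  have "purchase_weight t \<omega> \<le> V * purchase_cost a (sstate r t \<omega>)
      + (\<Sum>m\<in>UNIV. excess t \<omega> m * real (a m))"
    using purchase_minimizes[OF \<omega> a]
    by (simp add: purchase_weight_def jpp_purchase_obj_def excess_def mult.commute)
  moreover have "(\<Sum>k\<in>UNIV. of_bool (z k) * obj k (p k))
      \<le> (\<Sum>k\<in>UNIV. sale_weight t k \<omega> * mean_demand pl k (price r t \<omega> k) y)"
  proof (rule sum_mono)
    fix k
    have "obj k (p k) \<le> obj k (price r t \<omega> k)"
      unfolding obj_def y_def by (rule price_maximizes[OF \<omega> p not_blocked[OF \<omega>]])
    moreover have "offered r t \<omega> k \<longleftrightarrow> obj k (price r t \<omega> k) > 0"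
      using offered_iff[OF \<omega>, of t k] not_blocked[OF \<omega>] by (simp add: obj_def y_def)
    moreover have "sale_weight t k \<omega> * mean_demand pl k (price r t \<omega> k) y
        = of_bool (offered r t \<omega> k) * obj k (price r t \<omega> k)"
      by (simp add: sale_weight_def obj)
    ultimately show "of_bool (z k) * obj k (p k)
        \<le> sale_weight t k \<omega> * mean_demand pl k (price r t \<omega> k) y" by auto
  qed
  moreover have "(\<Sum>m\<in>UNIV. excess t \<omega> m * mean_surplus pl y m (a, z, p))
      - V * mean_profit pl (sstate r t \<omega>) y (a, z, p)
      = V * purchase_cost a (sstate r t \<omega>) + (\<Sum>m\<in>UNIV. excess t \<omega> m * real (a m))
        - (\<Sum>k\<in>UNIV. of_bool (z k) * obj k (p k))"
  proof -
    have "(\<Sum>k\<in>UNIV. of_bool (z k) * obj k (p k))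
        = V * (\<Sum>k\<in>UNIV. of_bool (z k) * (p k - alpha pl k) * mean_demand pl k (p k) y)
          + (\<Sum>k\<in>UNIV. \<Sum>m\<in>UNIV. excess t \<omega> m *
              (real (beta pl m k) * of_bool (z k) * mean_demand pl k (p k) y))"
      unfolding sum_distrib_left sum.distrib[symmetric]
      by (intro sum.cong refl) (simp add: obj sum_distrib_left algebra_simps)
    moreover have "(\<Sum>m\<in>UNIV. excess t \<omega> m * (\<Sum>k\<in>UNIV. real (beta pl m k) * of_bool (z k) *
          mean_demand pl k (p k) y))
        = (\<Sum>k\<in>UNIV. \<Sum>m\<in>UNIV. excess t \<omega> m *
            (real (beta pl m k) * of_bool (z k) * mean_demand pl k (p k) y))"
      unfolding sum_distrib_left by (rule sum.swap)
    ultimately show ?thesis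
      by (simp add: right_diff_distrib sum_subtractf algebra_simps)
  qed
  ultimately show ?thesis unfolding y_def by linarith
qed

lemma price_minus_alpha_bound:
  assumes "\<omega> \<in> space \<Omega>"
  shows "\<bar>price r t \<omega> k - alpha pl k\<bar> \<le> Pmax pl k + alpha pl k"
  using price_bounds[OF valid decisions_admissible(2)[OF assms, of t k]] alpha_nonneg[OF valid, of k]
  by linarith

lemma phi_actual_bound:
  assumes \<omega>: "\<omega> \<in> space \<Omega>"
  shows "\<bar>phi_actual pl r t \<omega>\<bar>
    \<le> cmax pl + (\<Sum>k\<in>UNIV. real (Dmax pl k) * (Pmax pl k + alpha pl k))"
proof -
  have "\<bar>\<Sum>k\<in>UNIV. of_bool (offered r t \<omega> k) * real (sold r t \<omega> k) * (price r t \<omega> k - alpha pl k)\<bar>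
      \<le> (\<Sum>k\<in>UNIV. real (Dmax pl k) * (Pmax pl k + alpha pl k))"
  proof (rule order_trans[OF sum_abs sum_mono])
    fix k
    have "of_bool (offered r t \<omega> k) * real (sold r t \<omega> k) \<le> real (Dmax pl k)"
      using decisions_admissible(3)[OF \<omega>, of t k] by (simp add: sold_eq[OF \<omega>])
    then have "of_bool (offered r t \<omega> k) * real (sold r t \<omega> k) * \<bar>price r t \<omega> k - alpha pl k\<bar>
        \<le> real (Dmax pl k) * (Pmax pl k + alpha pl k)"
      using price_minus_alpha_bound[OF \<omega>] by (intro mult_mono) auto
    then show "\<bar>of_bool (offered r t \<omega> k) * real (sold r t \<omega> k) * (price r t \<omega> k - alpha pl k)\<bar>
        \<le> real (Dmax pl k) * (Pmax pl k + alpha pl k)" by (simp add: abs_mult)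
  qed
  then show ?thesis
    using purchase_bounds(2,3)[OF valid states(1)[OF \<omega>] decisions_admissible(1)[OF \<omega>], of t]
    unfolding phi_actual_def by linarith
qed

lemma sale_weight_bound:
  assumes \<omega>: "\<omega> \<in> space \<Omega>"
  shows "\<bar>sale_weight t k \<omega>\<bar> \<le> V * (Pmax pl k + alpha pl k)
    + (\<Sum>m\<in>UNIV. real (beta pl m k) * max (theta pl V m) (Amax pl m))"
proof -
  let ?w = "V * (price r t \<omega> k - alpha pl k) + (\<Sum>m\<in>UNIV. real (beta pl m k) * excess t \<omega> m)"
  have "\<bar>\<Sum>m\<in>UNIV. real (beta pl m k) * excess t \<omega> m\<bar>
      \<le> (\<Sum>m\<in>UNIV. real (beta pl m k) * max (theta pl V m) (Amax pl m))"
    by (rule order_trans[OF sum_abs sum_mono])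
      (use excess_bound[OF \<omega>] in \<open>simp add: abs_mult mult_left_mono\<close>)
  moreover have "\<bar>V * (price r t \<omega> k - alpha pl k)\<bar> \<le> V * (Pmax pl k + alpha pl k)"
    using price_minus_alpha_bound[OF \<omega>, of t k] V_pos by (simp add: abs_mult)
  ultimately have "\<bar>?w\<bar> \<le> V * (Pmax pl k + alpha pl k)
      + (\<Sum>m\<in>UNIV. real (beta pl m k) * max (theta pl V m) (Amax pl m))" by linarith
  then show ?thesis unfolding sale_weight_def by (cases "offered r t \<omega> k") auto
qed

lemma purchase_weight_bound:
  assumes \<omega>: "\<omega> \<in> space \<Omega>"
  shows "\<bar>purchase_weight t \<omega>\<bar>
    \<le> V * cmax pl + (\<Sum>m\<in>UNIV. max (theta pl V m) (Amax pl m) * Amax pl m)"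
proof -
  note A = purchase_bounds[OF valid states(1)[OF \<omega>] decisions_admissible(1)[OF \<omega>], of t]
  have "\<bar>\<Sum>m\<in>UNIV. excess t \<omega> m * real (purchase r t \<omega> m)\<bar>
      \<le> (\<Sum>m\<in>UNIV. max (theta pl V m) (Amax pl m) * Amax pl m)"
  proof (rule order_trans[OF sum_abs sum_mono])
    fix m
    show "\<bar>excess t \<omega> m * real (purchase r t \<omega> m)\<bar> \<le> max (theta pl V m) (Amax pl m) * Amax pl m"
      unfolding abs_mult using excess_bound[OF \<omega>, of t m] A(1)[of m] Amax_nonneg[OF valid, of m]
      by (intro mult_mono) auto
  qed
  moreover have "\<bar>V * purchase_cost (purchase r t \<omega>) (sstate r t \<omega>)\<bar> \<le> V * cmax pl"
    using A(2,3) V_pos by (simp add: abs_mult)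
  ultimately show ?thesis unfolding purchase_weight_def by linarith
qed

lemma measurable_weights [measurable]:
  "(\<lambda>\<omega>. excess t \<omega> m) \<in> borel_measurable \<Omega>"
  "purchase_weight t \<in> borel_measurable \<Omega>"
  "sale_weight t k \<in> borel_measurable \<Omega>"
  "phi_actual pl r t \<in> borel_measurable \<Omega>"
proof -
  show [measurable]: "(\<lambda>\<omega>. excess t \<omega> m) \<in> borel_measurable \<Omega>" for t m
    unfolding excess_def by (rule decision_measurable[where h = "\<lambda>q _ _ _ _ _. of_int (q m) - theta pl V m"])
  have [measurable]: "(\<lambda>\<omega>. purchase_cost (purchase r t \<omega>) (sstate r t \<omega>)) \<in> borel_measurable \<Omega>"
    by (rule decision_measurable[where h = "\<lambda>_ x _ a _ _. purchase_cost a x"])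
  have [measurable]: "(\<lambda>\<omega>. real (purchase r t \<omega> m)) \<in> borel_measurable \<Omega>" for m
    by (rule decision_measurable[where h = "\<lambda>_ x _ a _ _. real (a m)"])
  have [measurable]: "(\<lambda>\<omega>. of_bool (offered r t \<omega> k) :: real) \<in> borel_measurable \<Omega>" for k
    by (rule decision_measurable[where h = "\<lambda>_ x _ _ _ z. of_bool (z k)"])
  have [measurable]: "(\<lambda>\<omega>. real (sold r t \<omega> k)) \<in> borel_measurable \<Omega>" for k
    by (rule measurable_compose[OF run_measurable(8)]) simp
  show "purchase_weight t \<in> borel_measurable \<Omega>" unfolding purchase_weight_def by measurable
  show "sale_weight t k \<in> borel_measurable \<Omega>" unfolding sale_weight_def by measurable
  show "phi_actual pl r t \<in> borel_measurable \<Omega>" unfolding phi_actual_def by measurable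
qed

lemma sale_weight_measurable_past: "sale_weight t k \<in> borel_measurable (past \<Omega> r t)"
  unfolding sale_weight_def excess_def
  by (rule decision_measurable_past[where h = "\<lambda>q _ _ _ p z. of_bool (z k) * (V * (p k - alpha pl k)
    + (\<Sum>m\<in>UNIV. real (beta pl m k) * (of_int (q m) - theta pl V m)))"])

lemma integrable_phi_actual: "integrable \<Omega> (phi_actual pl r t)"
  by (rule integrable_bounded[OF measurable_weights(4) phi_actual_bound])

lemma integrable_lyapunov: "integrable \<Omega> (lyapunov t)"
proof (rule integrable_bounded)
  show "lyapunov t \<in> borel_measurable \<Omega>" unfolding lyapunov_def by measurable
  show "\<bar>lyapunov t \<omega>\<bar> \<le> (1 / 2) * (\<Sum>m\<in>UNIV. (max (theta pl V m) (Amax pl m))\<^sup>2)"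
    if "\<omega> \<in> space \<Omega>" for \<omega>
  proof -
    have "(excess t \<omega> m)\<^sup>2 \<le> (max (theta pl V m) (Amax pl m))\<^sup>2" for m
      using power_mono[OF excess_bound[OF that, of t m], of 2] by simp
    then have "lyapunov t \<omega> \<le> (1 / 2) * (\<Sum>m\<in>UNIV. (max (theta pl V m) (Amax pl m))\<^sup>2)"
      unfolding lyapunov_def by (intro mult_left_mono sum_mono) auto
    then show ?thesis using lyapunov_nonneg[of t \<omega>] by simp
  qed
qed

lemma integrable_mult_bounded:
  assumes "f \<in> borel_measurable \<Omega>" "g \<in> borel_measurable \<Omega>"
    and "\<And>\<omega>. \<omega> \<in> space \<Omega> \<Longrightarrow> \<bar>f \<omega>\<bar> \<le> (a::real)" "\<And>\<omega>. \<omega> \<in> space \<Omega> \<Longrightarrow> \<bar>g \<omega>\<bar> \<le> (b::real)"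
  shows "integrable \<Omega> (\<lambda>\<omega>. f \<omega> * g \<omega>)"
proof (rule integrable_bounded)
  show "\<bar>f \<omega> * g \<omega>\<bar> \<le> a * b" if "\<omega> \<in> space \<Omega>" for \<omega>
    unfolding abs_mult using assms(3,4)[OF that] by (intro mult_mono) auto
qed (use assms in measurable)

end


section \<open>Comparison with a reference policy\<close>

context
  fixes pl :: "('m::finite, 'k::finite, 'y) plant" and y :: 'y
  assumes valid: "valid_plant pl" and y: "y \<in> demand_states pl"
begin

lemma measurable_decision_components:
  "(\<lambda>w. g (fst w)) \<in> borel_measurable (decision_space pl)"
  "(\<lambda>w. of_bool (fst (snd w) k) :: real) \<in> borel_measurable (decision_space pl)"
  "(\<lambda>w. snd (snd w) k) \<in> borel_measurable (decision_space pl)"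
  "(\<lambda>w. mean_demand pl k (snd (snd w) k) y) \<in> borel_measurable (decision_space pl)"
proof -
  have fst: "fst \<in> decision_space pl \<rightarrow>\<^sub>M count_space UNIV"
    and snd: "snd \<in> decision_space pl \<rightarrow>\<^sub>M pricing_space pl"
    by (auto simp: decision_space_def)
  have z: "fst \<in> pricing_space pl \<rightarrow>\<^sub>M count_space UNIV"
    and p: "snd \<in> pricing_space pl \<rightarrow>\<^sub>M (\<Pi>\<^sub>M k\<in>UNIV. restrict_space borel (price_set pl k))"
    by (auto simp: pricing_space_def)
  have pk: "(\<lambda>w. snd (snd w) k) \<in> decision_space pl \<rightarrow>\<^sub>M restrict_space borel (price_set pl k)"
    by (rule measurable_compose[OF measurable_compose[OF snd p] measurable_component_singleton]) simp
  show "(\<lambda>w. g (fst w)) \<in> borel_measurable (decision_space pl)"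
    by (rule measurable_compose[OF fst]) simp
  show "(\<lambda>w. of_bool (fst (snd w) k) :: real) \<in> borel_measurable (decision_space pl)"
    by (rule measurable_compose[OF measurable_compose[OF snd z]]) simp
  show "(\<lambda>w. snd (snd w) k) \<in> borel_measurable (decision_space pl)"
    by (rule measurable_compose[OF pk]) (auto intro: measurable_restrict_space1)
  have "continuous_on (price_set pl k) (\<lambda>p. mean_demand pl k p y)"
    using valid y unfolding valid_plant_def by blast
  then show "(\<lambda>w. mean_demand pl k (snd (snd w) k) y) \<in> borel_measurable (decision_space pl)"
    by (intro measurable_compose[OF pk] borel_measurable_continuous_on_restrict)
qed

lemma measurable_mean_profit: "mean_profit pl x y \<in> borel_measurable (decision_space pl)"
proof -
  note [measurable] = measurable_decision_components
  have "mean_profit pl x y = (\<lambda>w. - purchase_cost (fst w) x + (\<Sum>k\<in>UNIV. of_bool (fst (snd w) k)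
      * (snd (snd w) k - alpha pl k) * mean_demand pl k (snd (snd w) k) y))"
    by (auto simp: fun_eq_iff)
  then show ?thesis by simp
qed

lemma measurable_mean_surplus: "mean_surplus pl y m \<in> borel_measurable (decision_space pl)"
proof -
  note [measurable] = measurable_decision_components
  have "mean_surplus pl y m = (\<lambda>w. real (fst w m) - (\<Sum>k\<in>UNIV. real (beta pl m k)
      * of_bool (fst (snd w) k) * mean_demand pl k (snd (snd w) k) y))"
    by (auto simp: fun_eq_iff)
  then show ?thesis by simp
qed

end

locale jpp_reference = jpp_run \<Omega> pl r V
  for \<Omega> :: "'w measure"
    and pl :: "('m::finite, 'k::finite, 'y) plant"
    and r :: "('w, 'm, 'k, 'y) run"
    and V :: real +
  fixes W :: "nat \<Rightarrow> 'w \<Rightarrow> ('m, 'k) decision"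
  assumes W_measurable: "W t \<in> \<Omega> \<rightarrow>\<^sub>M decision_space pl"
    and W_purchase: "\<omega> \<in> space \<Omega> \<Longrightarrow> fst (W t \<omega>) \<in> purchases pl (sstate r t \<omega>)"
begin

lemma W_price:
  assumes "\<omega> \<in> space \<Omega>"
  shows "snd (snd (W t \<omega>)) k \<in> price_set pl k"
proof -
  have "W t \<omega> \<in> space (decision_space pl)"
    using measurable_space[OF W_measurable assms] .
  then show ?thesis
    by (auto simp: decision_space_def pricing_space_def space_pair_measure space_PiM
        space_restrict_space PiE_iff)
qed

lemma jpp_dominates_reference:
  assumes \<omega>: "\<omega> \<in> space \<Omega>"
  shows "purchase_weight t \<omega>
      - (\<Sum>k\<in>UNIV. sale_weight t k \<omega> * mean_demand pl k (price r t \<omega> k) (dstate r t \<omega>))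
    \<le> (\<Sum>m\<in>UNIV. excess t \<omega> m * surplus_star pl r W m t \<omega>) - V * phi_star pl r W t \<omega>"
proof -
  obtain a z p where W: "W t \<omega> = (a, z, p)" by (cases "W t \<omega>")
  then have "a \<in> purchases pl (sstate r t \<omega>)" "p k \<in> price_set pl k" for k
    using W_purchase[OF \<omega>, of t] W_price[OF \<omega>, of t k] by simp_all
  from jpp_minimizes_drift_bound[OF \<omega> this, of z] show ?thesis
    by (simp only: surplus_star_def phi_star_def W)
qed

lemma surplus_star_bound:
  assumes \<omega>: "\<omega> \<in> space \<Omega>"
  shows "\<bar>surplus_star pl r W m t \<omega>\<bar> \<le> maxstep m"
  using mean_surplus_bound[OF valid states[OF \<omega>, of t] W_purchase[OF \<omega>, of t],
      of "snd (snd (W t \<omega>))" m "fst (snd (W t \<omega>))"] W_price[OF \<omega>]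
  by (simp add: surplus_star_def maxstep_def)

lemma phi_star_bound:
  assumes \<omega>: "\<omega> \<in> space \<Omega>"
  shows "\<bar>phi_star pl r W t \<omega>\<bar>
    \<le> cmax pl + (\<Sum>k\<in>UNIV. (Pmax pl k + alpha pl k) * real (Dmax pl k))"
  using mean_profit_bound[OF valid states[OF \<omega>, of t] W_purchase[OF \<omega>, of t],
      of "snd (snd (W t \<omega>))" "fst (snd (W t \<omega>))"] W_price[OF \<omega>]
  by (simp add: phi_star_def)

text \<open>For fixed states the mean profit and surplus are measurable functions of the decisions, since
  mean demand is continuous in the price. Countability of the state spaces extends this to random
  states.\<close>

lemma measurable_reference [measurable]:
  "phi_star pl r W t \<in> borel_measurable \<Omega>"
  "surplus_star pl r W m t \<in> borel_measurable \<Omega>"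
proof -
  have "(\<lambda>\<omega>. mean_profit pl (sstate r t \<omega>) y (W t \<omega>)) \<in> borel_measurable \<Omega>"
    if "y \<in> demand_states pl" for y
    by (rule measurable_compose_countable'[OF _ run_measurable(1) countable_states(1)])
      (rule measurable_compose[OF W_measurable measurable_mean_profit[OF valid that]])
  then have "(\<lambda>\<omega>. mean_profit pl (sstate r t \<omega>) (dstate r t \<omega>) (W t \<omega>)) \<in> borel_measurable \<Omega>"
    by (rule measurable_compose_countable'[OF _ run_measurable(2) countable_states(2)])
  then show "phi_star pl r W t \<in> borel_measurable \<Omega>" by (simp add: phi_star_def[abs_def])
  have "(\<lambda>\<omega>. mean_surplus pl (dstate r t \<omega>) m (W t \<omega>)) \<in> borel_measurable \<Omega>"
    by (rule measurable_compose_countable'[OF _ run_measurable(2) countable_states(2)])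
      (rule measurable_compose[OF W_measurable measurable_mean_surplus[OF valid]])
  then show "surplus_star pl r W m t \<in> borel_measurable \<Omega>" by (simp add: surplus_star_def[abs_def])
qed

lemma integrable_reference:
  "integrable \<Omega> (phi_star pl r W t)"
  "integrable \<Omega> (\<lambda>\<omega>. excess s \<omega> m * surplus_star pl r W m t \<omega>)"
proof -
  show "integrable \<Omega> (phi_star pl r W t)"
    by (rule integrable_bounded[OF _ phi_star_bound]) simp_all
  show "integrable \<Omega> (\<lambda>\<omega>. excess s \<omega> m * surplus_star pl r W m t \<omega>)"
    by (rule integrable_mult_bounded[OF _ _ excess_bound surplus_star_bound]) simp_all
qed

text \<open>Taking expectations bridges the gap between the two pathwise estimates: the drift bound
  contains the demands themselves, the comparison of decisions only their means.\<close>

lemma expected_drift: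
  "(\<integral>\<omega>. lyapunov (Suc t) \<omega> \<partial>\<Omega>) - V * (\<integral>\<omega>. phi_actual pl r t \<omega> \<partial>\<Omega>)
    \<le> (\<integral>\<omega>. lyapunov t \<omega> \<partial>\<Omega>) + drift_const pl - V * (\<integral>\<omega>. phi_star pl r W t \<omega> \<partial>\<Omega>)
      + (\<Sum>m\<in>UNIV. \<integral>\<omega>. excess t \<omega> m * surplus_star pl r W m t \<omega> \<partial>\<Omega>)"
proof -
  define F where "F k \<omega> = mean_demand pl k (price r t \<omega> k) (dstate r t \<omega>)" for k \<omega>
  have F [measurable]: "F k \<in> borel_measurable \<Omega>" for k
    unfolding F_def by (rule decision_measurable[where h = "\<lambda>_ _ y _ p _. mean_demand pl k (p k) y"])
  have F_bound: "\<bar>F k \<omega>\<bar> \<le> real (Dmax pl k)" if "\<omega> \<in> space \<Omega>" for k \<omega>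
    using mean_demand_bounds[OF valid decisions_admissible(2)[OF that] states(2)[OF that]]
    by (simp add: F_def)
  have D [measurable]: "(\<lambda>\<omega>. real (demand r t \<omega> k)) \<in> borel_measurable \<Omega>" for k
    by (rule measurable_compose[OF run_measurable(7)]) simp
  have iD: "integrable \<Omega> (\<lambda>\<omega>. sale_weight t k \<omega> * real (demand r t \<omega> k))" for k
    by (rule integrable_mult_bounded[OF _ D sale_weight_bound, where b = "real (Dmax pl k)"])
      (auto simp: decisions_admissible(3))
  have iF: "integrable \<Omega> (\<lambda>\<omega>. sale_weight t k \<omega> * F k \<omega>)" for k
    by (rule integrable_mult_bounded[OF _ F sale_weight_bound F_bound]) simp_all
  have iG: "integrable \<Omega> (purchase_weight t)"
    by (rule integrable_bounded[OF _ purchase_weight_bound]) simp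
  note [simp] = iD iF iG integrable_reference integrable_lyapunov integrable_phi_actual
  have "(\<integral>\<omega>. lyapunov (Suc t) \<omega> \<partial>\<Omega>) - V * (\<integral>\<omega>. phi_actual pl r t \<omega> \<partial>\<Omega>)
      = (\<integral>\<omega>. lyapunov (Suc t) \<omega> - V * phi_actual pl r t \<omega> \<partial>\<Omega>)"
    by simp
  also have "\<dots> \<le> (\<integral>\<omega>. lyapunov t \<omega> + drift_const pl + purchase_weight t \<omega>
      - (\<Sum>k\<in>UNIV. sale_weight t k \<omega> * real (demand r t \<omega> k)) \<partial>\<Omega>)"
    by (intro integral_mono drift_minus_profit) simp_all
  also have "\<dots> = (\<integral>\<omega>. lyapunov t \<omega> \<partial>\<Omega>) + drift_const pl + (\<integral>\<omega>. purchase_weight t \<omega> \<partial>\<Omega>)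
      - (\<Sum>k\<in>UNIV. \<integral>\<omega>. sale_weight t k \<omega> * real (demand r t \<omega> k) \<partial>\<Omega>)"
    by (simp add: prob_space)
  also have "(\<Sum>k\<in>UNIV. \<integral>\<omega>. sale_weight t k \<omega> * real (demand r t \<omega> k) \<partial>\<Omega>)
      = (\<Sum>k\<in>UNIV. \<integral>\<omega>. sale_weight t k \<omega> * F k \<omega> \<partial>\<Omega>)"
    unfolding F_def
    by (intro sum.cong refl expectation_demand[OF sale_weight_measurable_past sale_weight_bound])
  also have "(\<integral>\<omega>. lyapunov t \<omega> \<partial>\<Omega>) + drift_const pl + (\<integral>\<omega>. purchase_weight t \<omega> \<partial>\<Omega>)
      - (\<Sum>k\<in>UNIV. \<integral>\<omega>. sale_weight t k \<omega> * F k \<omega> \<partial>\<Omega>)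
      = (\<integral>\<omega>. lyapunov t \<omega> \<partial>\<Omega>) + drift_const pl
        + (\<integral>\<omega>. purchase_weight t \<omega> - (\<Sum>k\<in>UNIV. sale_weight t k \<omega> * F k \<omega>) \<partial>\<Omega>)"
    by simp
  also have "\<dots> \<le> (\<integral>\<omega>. lyapunov t \<omega> \<partial>\<Omega>) + drift_const pl
        + (\<integral>\<omega>. (\<Sum>m\<in>UNIV. excess t \<omega> m * surplus_star pl r W m t \<omega>) - V * phi_star pl r W t \<omega> \<partial>\<Omega>)"
    unfolding F_def using iF
    by (intro add_left_mono integral_mono jpp_dominates_reference) (simp_all add: F_def)
  finally show ?thesis by simp
qed

text \<open>The reference policy is nearly balanced only on average over \<open>T\<close> slots, whereas the excess
  varies within them. Freezing the excess at the beginning of the block makes the balance estimate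
  applicable, because the inventory is part of the history. Since the excess moves by at most
  \<open>maxstep m\<close> per slot, the error is \<open>(maxstep m)\<^sup>2\<close> times \<open>0 + 1 + \<dots> + (T - 1)\<close>.\<close>

lemma excess_surplus_block:
  assumes mem: "memory_bound \<Omega> pl r W \<phi>opt \<epsilon> T" and T: "T > 0"
  shows "(\<Sum>\<tau>=t..<t+T. \<integral>\<omega>. excess \<tau> \<omega> m * surplus_star pl r W m \<tau> \<omega> \<partial>\<Omega>)
    \<le> real T * \<epsilon> * max (theta pl V m) (Amax pl m) + real T * (real T - 1) / 2 * (maxstep m)\<^sup>2"
proof -
  interpret H: finite_measure_subalgebra \<Omega> "history \<Omega> r t"
    by (rule finite_measure_subalgebraI[OF subalgebra_history])
  let ?R = "max (theta pl V m) (Amax pl m)"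
  let ?s = "\<lambda>\<tau>. surplus_star pl r W m \<tau>"
  let ?c = "\<lambda>\<tau>. real_cond_exp \<Omega> (history \<Omega> r t) (?s \<tau>)"
  have bH: "(\<lambda>\<omega>. excess t \<omega> m) \<in> borel_measurable (history \<Omega> r t)"
    unfolding excess_def by (rule measurable_compose[OF inventory_measurable_history]) simp
  note cond = H.real_cond_exp_intg[OF integrable_reference(2) bH measurable_reference(2)]
  have frozen: "(\<Sum>\<tau>=t..<t+T. \<integral>\<omega>. excess t \<omega> m * ?s \<tau> \<omega> \<partial>\<Omega>) \<le> real T * \<epsilon> * ?R"
  proof -
    have "(\<Sum>\<tau>=t..<t+T. \<integral>\<omega>. excess t \<omega> m * ?s \<tau> \<omega> \<partial>\<Omega>)
        = (\<integral>\<omega>. (\<Sum>\<tau>=t..<t+T. excess t \<omega> m * ?c \<tau> \<omega>) \<partial>\<Omega>)"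
      by (simp add: cond)
    also have "\<dots> \<le> real T * \<epsilon> * ?R"
    proof (rule integral_le_bound)
      show "integrable \<Omega> (\<lambda>\<omega>. \<Sum>\<tau>=t..<t+T. excess t \<omega> m * ?c \<tau> \<omega>)" by (simp add: cond)
      have "AE \<omega> in \<Omega>. \<bar>(1 / real T) * (\<Sum>\<tau>=t..<t+T. ?c \<tau> \<omega>)\<bar> \<le> \<epsilon>"
        using mem unfolding memory_bound_def by blast
      then show "AE \<omega> in \<Omega>. (\<Sum>\<tau>=t..<t+T. excess t \<omega> m * ?c \<tau> \<omega>) \<le> real T * \<epsilon> * ?R"
      proof (rule AE_mp, intro AE_I2 impI)
        fix \<omega> assume \<omega>: "\<omega> \<in> space \<Omega>" and eps: "\<bar>(1 / real T) * (\<Sum>\<tau>=t..<t+T. ?c \<tau> \<omega>)\<bar> \<le> \<epsilon>"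
        have "\<bar>\<Sum>\<tau>=t..<t+T. ?c \<tau> \<omega>\<bar> \<le> real T * \<epsilon>"
          using eps T by (simp add: abs_mult field_simps)
        then have "\<bar>excess t \<omega> m\<bar> * \<bar>\<Sum>\<tau>=t..<t+T. ?c \<tau> \<omega>\<bar> \<le> ?R * (real T * \<epsilon>)"
          using excess_bound[OF \<omega>, of t m] by (intro mult_mono) auto
        then show "(\<Sum>\<tau>=t..<t+T. excess t \<omega> m * ?c \<tau> \<omega>) \<le> real T * \<epsilon> * ?R"
          unfolding sum_distrib_left[symmetric]
          using abs_ge_self[of "excess t \<omega> m * (\<Sum>\<tau>=t..<t+T. ?c \<tau> \<omega>)"]
          by (simp add: abs_mult mult_ac)
      qed
    qed
    finally show ?thesis .
  qed
  have moved: "(\<integral>\<omega>. excess \<tau> \<omega> m * ?s \<tau> \<omega> \<partial>\<Omega>)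
      \<le> (\<integral>\<omega>. excess t \<omega> m * ?s \<tau> \<omega> \<partial>\<Omega>) + real (\<tau> - t) * (maxstep m)\<^sup>2"
    if \<tau>: "\<tau> \<ge> t" for \<tau>
  proof -
    have "(\<integral>\<omega>. excess \<tau> \<omega> m * ?s \<tau> \<omega> - excess t \<omega> m * ?s \<tau> \<omega> \<partial>\<Omega>) \<le> real (\<tau> - t) * (maxstep m)\<^sup>2"
    proof (rule integral_le_bound, simp add: integrable_reference, intro AE_I2)
      fix \<omega> assume \<omega>: "\<omega> \<in> space \<Omega>"
      have "\<bar>excess \<tau> \<omega> m - excess t \<omega> m\<bar> \<le> real (\<tau> - t) * maxstep m"
        using excess_diff_bound[OF \<omega>, of t "\<tau> - t" m] \<tau> by simp
      then have "\<bar>excess \<tau> \<omega> m - excess t \<omega> m\<bar> * \<bar>?s \<tau> \<omega>\<bar> \<le> real (\<tau> - t) * maxstep m * maxstep m"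
        using surplus_star_bound[OF \<omega>] maxstep_nonneg by (intro mult_mono) auto
      then show "excess \<tau> \<omega> m * ?s \<tau> \<omega> - excess t \<omega> m * ?s \<tau> \<omega> \<le> real (\<tau> - t) * (maxstep m)\<^sup>2"
        unfolding left_diff_distrib[symmetric] abs_mult[symmetric] power2_eq_square mult.assoc
        by linarith
    qed
    then show ?thesis by (simp add: integrable_reference)
  qed
  have steps: "(\<Sum>\<tau>=t..<t+T. real (\<tau> - t)) = real T * (real T - 1) / 2"
    by (induction T) (simp_all add: field_simps)
  have "(\<Sum>\<tau>=t..<t+T. \<integral>\<omega>. excess \<tau> \<omega> m * ?s \<tau> \<omega> \<partial>\<Omega>)
      \<le> (\<Sum>\<tau>=t..<t+T. (\<integral>\<omega>. excess t \<omega> m * ?s \<tau> \<omega> \<partial>\<Omega>) + real (\<tau> - t) * (maxstep m)\<^sup>2)"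
    by (intro sum_mono moved) simp
  also have "\<dots> = (\<Sum>\<tau>=t..<t+T. \<integral>\<omega>. excess t \<omega> m * ?s \<tau> \<omega> \<partial>\<Omega>)
      + real T * (real T - 1) / 2 * (maxstep m)\<^sup>2"
    by (simp only: sum.distrib sum_distrib_right[symmetric] steps)
  finally show ?thesis using frozen by linarith
qed

lemma phi_star_block:
  assumes mem: "memory_bound \<Omega> pl r W \<phi>opt \<epsilon> T" and T: "T > 0"
  shows "(\<Sum>\<tau>=t..<t+T. \<integral>\<omega>. phi_star pl r W \<tau> \<omega> \<partial>\<Omega>) \<ge> real T * (\<phi>opt - \<epsilon>)"
proof -
  interpret H: finite_measure_subalgebra \<Omega> "history \<Omega> r t"
    by (rule finite_measure_subalgebraI[OF subalgebra_history])
  let ?c = "\<lambda>\<tau>. real_cond_exp \<Omega> (history \<Omega> r t) (phi_star pl r W \<tau>)"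
  note cond = H.real_cond_exp_int[OF integrable_reference(1)]
  have "(\<integral>\<omega>. real T * \<phi>opt - (\<Sum>\<tau>=t..<t+T. ?c \<tau> \<omega>) \<partial>\<Omega>) \<le> real T * \<epsilon>"
  proof (rule integral_le_bound)
    show "integrable \<Omega> (\<lambda>\<omega>. real T * \<phi>opt - (\<Sum>\<tau>=t..<t+T. ?c \<tau> \<omega>))" by (simp add: cond)
    have "AE \<omega> in \<Omega>. \<bar>\<phi>opt - (1 / real T) * (\<Sum>\<tau>=t..<t+T. ?c \<tau> \<omega>)\<bar> \<le> \<epsilon>"
      using mem unfolding memory_bound_def by blast
    then show "AE \<omega> in \<Omega>. real T * \<phi>opt - (\<Sum>\<tau>=t..<t+T. ?c \<tau> \<omega>) \<le> real T * \<epsilon>"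
    proof eventually_elim
      case (elim \<omega>)
      then have "real T * (\<phi>opt - (1 / real T) * (\<Sum>\<tau>=t..<t+T. ?c \<tau> \<omega>)) \<le> real T * \<epsilon>"
        by (intro mult_left_mono) auto
      then show ?case using T by (simp add: right_diff_distrib)
    qed
  qed
  then show ?thesis by (simp add: cond prob_space right_diff_distrib)
qed

text \<open>The term quadratic in \<open>T\<close> has two sources: every slot contributes \<open>drift_const pl\<close> to the
  drift, and the error from freezing the excess contributes \<open>T * (T - 1) * drift_const pl\<close> to the
  block. Together they make \<open>T\<^sup>2 * drift_const pl\<close>. The telescoping drift itself is kept.\<close>

lemma expected_profit_block:
  assumes mem: "memory_bound \<Omega> pl r W \<phi>opt \<epsilon> T" and T: "T > 0"
  shows "(\<Sum>\<tau>=t..<t+T. \<integral>\<omega>. phi_actual pl r \<tau> \<omega> \<partial>\<Omega>)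
    \<ge> real T * (\<phi>opt - real T * drift_const pl / V
          - \<epsilon> * (1 + (\<Sum>m\<in>UNIV. max (theta pl V m) (Amax pl m) / V)))
      + ((\<integral>\<omega>. lyapunov (t + T) \<omega> \<partial>\<Omega>) / V - (\<integral>\<omega>. lyapunov t \<omega> \<partial>\<Omega>) / V)"
proof -
  define L where "L t = (\<integral>\<omega>. lyapunov t \<omega> \<partial>\<Omega>)" for t
  define f where "f \<tau> = (\<integral>\<omega>. phi_actual pl r \<tau> \<omega> \<partial>\<Omega>)" for \<tau>
  define g where "g \<tau> = (\<integral>\<omega>. phi_star pl r W \<tau> \<omega> \<partial>\<Omega>)" for \<tau>
  define e where "e \<tau> m = (\<integral>\<omega>. excess \<tau> \<omega> m * surplus_star pl r W m \<tau> \<omega> \<partial>\<Omega>)" for \<tau> m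
  define R where "R = (\<Sum>m\<in>UNIV. max (theta pl V m) (Amax pl m))"
  have drift: "L (Suc \<tau>) - L \<tau> - V * f \<tau> \<le> drift_const pl - V * g \<tau> + (\<Sum>m\<in>UNIV. e \<tau> m)" for \<tau>
    using expected_drift[of \<tau>] by (simp add: L_def f_def g_def e_def)
  have "L (t + T) - L t - V * (\<Sum>\<tau>=t..<t+T. f \<tau>)
      = (\<Sum>\<tau>=t..<t+T. L (Suc \<tau>) - L \<tau> - V * f \<tau>)"
    by (simp add: sum_subtractf sum_Suc_diff' flip: sum_distrib_left)
      (simp flip: sum_subtractf add: sum_Suc_diff')
  also have "\<dots> \<le> (\<Sum>\<tau>=t..<t+T. drift_const pl - V * g \<tau> + (\<Sum>m\<in>UNIV. e \<tau> m))"
    by (intro sum_mono drift)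
  also have "\<dots> = real T * drift_const pl - V * (\<Sum>\<tau>=t..<t+T. g \<tau>)
      + (\<Sum>m\<in>UNIV. \<Sum>\<tau>=t..<t+T. e \<tau> m)"
    by (simp add: sum.distrib sum_subtractf sum_distrib_left sum.swap[of _ UNIV])
  also have "\<dots> \<le> real T * drift_const pl - V * (real T * (\<phi>opt - \<epsilon>))
      + (\<Sum>m\<in>UNIV. real T * \<epsilon> * max (theta pl V m) (Amax pl m)
          + real T * (real T - 1) / 2 * (maxstep m)\<^sup>2)"
  proof (intro add_mono diff_mono sum_mono order_refl mult_left_mono)
    show "real T * (\<phi>opt - \<epsilon>) \<le> (\<Sum>\<tau>=t..<t+T. g \<tau>)"
      unfolding g_def by (rule phi_star_block[OF mem T])
    show "(\<Sum>\<tau>=t..<t+T. e \<tau> m) \<le> real T * \<epsilon> * max (theta pl V m) (Amax pl m)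
        + real T * (real T - 1) / 2 * (maxstep m)\<^sup>2" for m
      unfolding e_def by (rule excess_surplus_block[OF mem T])
  qed (use V_pos in simp)
  also have "(\<Sum>m\<in>UNIV. real T * \<epsilon> * max (theta pl V m) (Amax pl m)
          + real T * (real T - 1) / 2 * (maxstep m)\<^sup>2)
      = real T * \<epsilon> * R + real T * (real T - 1) * drift_const pl"
    unfolding R_def drift_const_eq
    by (simp add: sum.distrib sum_distrib_left sum_divide_distrib mult_ac)
  finally have "V * (\<Sum>\<tau>=t..<t+T. f \<tau>) \<ge> real T * (V * (\<phi>opt - \<epsilon>) - real T * drift_const pl - \<epsilon> * R)
      + (L (t + T) - L t)"
    by (simp add: algebra_simps)
  then have "(\<Sum>\<tau>=t..<t+T. f \<tau>) \<ge> (real T * (V * (\<phi>opt - \<epsilon>) - real T * drift_const pl - \<epsilon> * R)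
      + (L (t + T) - L t)) / V"
    using V_pos by (simp add: field_simps)
  also have "(real T * (V * (\<phi>opt - \<epsilon>) - real T * drift_const pl - \<epsilon> * R) + (L (t + T) - L t)) / V
      = real T * (\<phi>opt - real T * drift_const pl / V - \<epsilon> * (1 + R / V)) + (L (t + T) / V - L t / V)"
    using V_pos by (simp add: field_simps)
  finally show ?thesis by (simp add: L_def f_def R_def sum_divide_distrib)
qed

lemma average_profit_bound:
  assumes mem: "memory_bound \<Omega> pl r W \<phi>opt \<epsilon> T" and T: "T > 0"
  shows "liminf (\<lambda>t. ereal ((1 / real t) * (\<Sum>\<tau><t. \<integral>\<omega>. phi_actual pl r \<tau> \<omega> \<partial>\<Omega>)))
    \<ge> ereal (\<phi>opt - real T * drift_const pl / V
        - \<epsilon> * (1 + (\<Sum>m\<in>UNIV. max (theta pl V m) (Amax pl m) / V)))"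
proof (rule liminf_average_ge_of_block_bounds[OF T])
  let ?C = "cmax pl + (\<Sum>k\<in>UNIV. real (Dmax pl k) * (Pmax pl k + alpha pl k))"
  show "\<bar>\<integral>\<omega>. phi_actual pl r t \<omega> \<partial>\<Omega>\<bar> \<le> ?C" for t
  proof -
    have "\<bar>\<integral>\<omega>. phi_actual pl r t \<omega> \<partial>\<Omega>\<bar> \<le> (\<integral>\<omega>. \<bar>phi_actual pl r t \<omega>\<bar> \<partial>\<Omega>)"
      by (rule integral_abs_bound)
    also have "\<dots> \<le> ?C"
      by (rule integral_le_bound) (auto simp: integrable_phi_actual phi_actual_bound)
    finally show ?thesis .
  qed
  show "(\<integral>\<omega>. lyapunov t \<omega> \<partial>\<Omega>) / V \<ge> 0" for t
    using V_pos lyapunov_nonneg by (intro divide_nonneg_pos integral_nonneg_AE) auto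
qed (rule expected_profit_block[OF mem T])

end


section \<open>Inventory bounds and average profit\<close>

theorem theorem4:
  fixes \<Omega> :: "'w measure"
    and pl :: "('m::finite, 'k::finite, 'y) plant"
    and r :: "('w, 'm, 'k, 'y) run"
    and \<pi>x :: "'m supply_state pmf" and \<pi>y :: "'y pmf"
    and \<kappa> :: "'m supply_state \<Rightarrow> 'y \<Rightarrow> ('m, 'k) decision measure"
    and W :: "nat \<Rightarrow> 'w \<Rightarrow> ('m, 'k) decision"
    and \<phi>opt V :: real
  assumes "prob_space \<Omega>"
    and "valid_plant pl"
    and "plant_run \<Omega> pl r"
    and "time_averages \<Omega> pl r \<pi>x \<pi>y"
    and "is_optimal_profit pl \<pi>x \<pi>y \<phi>opt"
    and "optimal_xy_policy pl \<pi>x \<pi>y \<phi>opt \<kappa>"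
    and "xy_decisions \<Omega> pl r \<kappa> W"
    and "decaying_memory \<Omega> pl r W \<phi>opt"
    and "V > 0"
    and "follows_jpp \<Omega> pl V (theta pl V) r"
    and "\<forall>\<omega>\<in>space \<Omega>. \<forall>m. mu_max pl m \<le> of_int (inventory r 0 \<omega> m) \<and>
           of_int (inventory r 0 \<omega> m) \<le> theta pl V m + Amax pl m"
  shows "(\<forall>\<omega>\<in>space \<Omega>. \<forall>m t. mu_max pl m \<le> of_int (inventory r t \<omega> m) \<and>
            of_int (inventory r t \<omega> m) \<le> Qmax pl V m) \<and>
         (\<forall>m. (\<lambda>v. Qmax pl v m) \<in> O[at_top](\<lambda>v. v)) \<and>
         (\<forall>\<epsilon>>0. \<forall>T>0. memory_bound \<Omega> pl r W \<phi>opt \<epsilon> T \<longrightarrow>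
            liminf (\<lambda>t. ereal ((1 / real t) * (\<Sum>\<tau><t. \<integral>\<omega>. phi_actual pl r \<tau> \<omega> \<partial>\<Omega>)))
              \<ge> ereal (\<phi>opt - real T * drift_const pl / V
                  - \<epsilon> * (1 + (\<Sum>m\<in>UNIV. max (theta pl V m) (Amax pl m) / V))))"
proof -
  interpret prob_space \<Omega> by fact
  interpret jpp_reference \<Omega> pl r V W
    using assms unfolding xy_decisions_def by unfold_locales blast+
  show ?thesis
    unfolding Qmax_def[of pl V]
    using inventory_bounds Qmax_bigo[OF valid] average_profit_bound by blast
qed

end
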